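(* Let $A$ be a finite alphabet, let $M_A$ be the free inverse monoid on $A$, let $\varphi$ be a monoid endomorphism of $M_A$ with induced endomorphism $\overline{\varphi}$ of the free group $F_A$, and let $N=\mathrm{Curl}(\overline{\varphi})$. Then the radical $\mathrm{Rad}_N(\varphi)$ is a context-free subset of $M_A$.
   Context: Let $A^{-1}$ be a set of formal inverses of $A$, $\widetilde{A}=A\cup A^{-1}$, and extend $a\mapsto a^{-1}$ to an involution on the free monoid $\widetilde{A}^*$ by $1^{-1}=1$, $(a^{-1})^{-1}=a$, $(uv)^{-1}=v^{-1}u^{-1}$. The free inverse monoid $M_A$ is the quotient of $\widetilde{A}^*$ by the congruence generated by $\{(uu^{-1}u,u)\mid u\in\widetilde{A}^*\}\cup\{(uu^{-1}vv^{-1},vv^{-1}uu^{-1})\mid u,v\in\widetilde{A}^*\}$, and $\pi:\widetilde{A}^*\to M_A$ is the canonical homomorphism. $F_A$ is the free group on $A$, $\sigma':M_A\to F_A$ is the canonical homomorphism, and for $u\in M_A$ we write $\overline{u}=u\sigma'$. Maps are written on the right. Any endomorphism $\varphi$ of $M_A$ induces a well-defined endomorphism $\overline{\varphi}$ of $F_A$: if $g=u\sigma'$ with $u\in M_A$, then $g\overline{\varphi}=u\varphi\sigma'$. For an endomorphism $\psi$ of a monoid $M$, $\mathrm{Fix}(\psi)=\{x\in M: x\psi=x\}$ and $\mathrm{Per}(\psi)=\bigcup_{n\ge 1}\mathrm{Fix}(\psi^n)$. For $\theta\in\mathrm{End}(F_A)$ it is known that $\mathrm{Per}(\theta)=\mathrm{Fix}(\theta^N)$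 for some $N\ge1$; the minimum such $N$ is the curl $\mathrm{Curl}(\theta)$. For $n\ge1$, $\mathrm{Rad}_n(\varphi)=\{u\in\mathrm{Fix}(\varphi^n)\mid \overline{u}\in\mathrm{Fix}(\overline{\varphi})\}$. A subset $X\subseteq M_A$ is context-free if $X=L\pi$ for some context-free language $L\subseteq\widetilde{A}^*$. *)

theory Defs
  imports "HOL-Algebra.Group"
begin

section \<open>Words over an alphabet and its formal inverses\<close>

datatype 'a letter = Gen 'a | Inv 'a

type_synonym 'a word = "'a letter list"

fun letter_inv :: "'a letter \<Rightarrow> 'a letter" where
  "letter_inv (Gen a) = Inv a"
| "letter_inv (Inv a) = Gen a"

definition word_inv :: "'a word \<Rightarrow> 'a word" where
  "word_inv w = rev (map letter_inv w)"

definition words :: "'a set \<Rightarrow> 'a word set" where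
  "words A = lists (Gen ` A \<union> Inv ` A)"

lemma letter_inv_letter_inv [simp]: "letter_inv (letter_inv x) = x"
  by (cases x) auto

lemma word_inv_word_inv [simp]: "word_inv (word_inv w) = w"
  by (simp add: word_inv_def rev_map comp_def)

lemma word_inv_Nil [simp]: "word_inv [] = []"
  by (simp add: word_inv_def)

lemma word_inv_append [simp]: "word_inv (u @ v) = word_inv v @ word_inv u"
  by (simp add: word_inv_def)

lemma Nil_in_words [simp]: "[] \<in> words A"
  by (simp add: words_def)

lemma append_in_words [simp]: "u @ v \<in> words A \<longleftrightarrow> u \<in> words A \<and> v \<in> words A"
  by (auto simp: words_def)

lemma letter_inv_in: "x \<in> Gen ` A \<union> Inv ` A \<Longrightarrow> letter_inv x \<in> Gen ` A \<union> Inv ` A"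
  by auto

lemma word_inv_in_words [simp]: "u \<in> words A \<Longrightarrow> word_inv u \<in> words A"
  unfolding words_def word_inv_def in_lists_conv_set using letter_inv_in by fastforce


section \<open>Monoids presented by generators and relations\<close>

text \<open>The congruence on the free monoid \<open>words A\<close> generated by a relation \<open>R \<subseteq> words A \<times> words A\<close>.\<close>

inductive_set gen_cong :: "'a set \<Rightarrow> ('a word \<times> 'a word) set \<Rightarrow> ('a word \<times> 'a word) set"
  for A :: "'a set" and R :: "('a word \<times> 'a word) set" where
  base: "(u, v) \<in> R \<Longrightarrow> (u, v) \<in> gen_cong A R"
| refl: "u \<in> words A \<Longrightarrow> (u, u) \<in> gen_cong A R"
| sym: "(u, v) \<in> gen_cong A R \<Longrightarrow> (v, u) \<in> gen_cong A R"
| trans: "(u, v) \<in> gen_cong A R \<Longrightarrow> (v, w) \<in> gen_cong A R \<Longrightarrow> (u, w) \<in> gen_cong A R"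
| mult: "(u, v) \<in> gen_cong A R \<Longrightarrow> (s, t) \<in> gen_cong A R \<Longrightarrow> (u @ s, v @ t) \<in> gen_cong A R"

definition quot_monoid :: "'a set \<Rightarrow> ('a word \<times> 'a word) set \<Rightarrow> 'a word set monoid" where
  "quot_monoid A r =
     \<lparr> carrier = words A // r,
       mult = (\<lambda>X Y. \<Union>x\<in>X. \<Union>y\<in>Y. r `` {x @ y}),
       one = r `` {[]} \<rparr>"

definition fim_rels :: "'a set \<Rightarrow> ('a word \<times> 'a word) set" where
  "fim_rels A =
     {(u @ word_inv u @ u, u) | u. u \<in> words A} \<union>
     {(u @ word_inv u @ v @ word_inv v, v @ word_inv v @ u @ word_inv u) | u v.
        u \<in> words A \<and> v \<in> words A}"

definition fim_cong :: "'a set \<Rightarrow> ('a word \<times> 'a word) set" where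
  "fim_cong A = gen_cong A (fim_rels A)"

definition free_inverse_monoid :: "'a set \<Rightarrow> 'a word set monoid" where
  "free_inverse_monoid A = quot_monoid A (fim_cong A)"

definition fg_rels :: "'a set \<Rightarrow> ('a word \<times> 'a word) set" where
  "fg_rels A = {([x, letter_inv x], []) | x. x \<in> Gen ` A \<union> Inv ` A}"

definition fg_cong :: "'a set \<Rightarrow> ('a word \<times> 'a word) set" where
  "fg_cong A = gen_cong A (fg_rels A)"

definition free_group :: "'a set \<Rightarrow> 'a word set monoid" where
  "free_group A = quot_monoid A (fg_cong A)"

text \<open>The canonical homomorphisms from the free monoid to the free inverse monoid
  (\<open>fim_proj\<close>), and from the free inverse monoid to the free group (\<open>fim_to_fg\<close>,
  the class of \<open>u\<close> being sent to the class of \<open>u\<close>).\<close>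

definition fim_proj :: "'a set \<Rightarrow> 'a word \<Rightarrow> 'a word set" where
  "fim_proj A u = fim_cong A `` {u}"

definition fim_to_fg :: "'a set \<Rightarrow> 'a word set \<Rightarrow> 'a word set" where
  "fim_to_fg A X = (\<Union>u\<in>X. fg_cong A `` {u})"


section \<open>Endomorphisms, fixed and periodic points\<close>

text \<open>The set \<open>hom\<close> of the library only demands multiplicativity.\<close>

definition monoid_End :: "('b, 'c) monoid_scheme \<Rightarrow> ('b \<Rightarrow> 'b) set" where
  "monoid_End M = {\<phi> \<in> hom M M. \<phi> \<one>\<^bsub>M\<^esub> = \<one>\<^bsub>M\<^esub>}"

definition Fix :: "('b, 'c) monoid_scheme \<Rightarrow> ('b \<Rightarrow> 'b) \<Rightarrow> 'b set" where
  "Fix M \<psi> = {x \<in> carrier M. \<psi> x = x}"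

definition Per :: "('b, 'c) monoid_scheme \<Rightarrow> ('b \<Rightarrow> 'b) \<Rightarrow> 'b set" where
  "Per M \<psi> = (\<Union>n\<in>{1..}. Fix M (\<psi> ^^ n))"

definition Curl :: "'a set \<Rightarrow> ('a word set \<Rightarrow> 'a word set) \<Rightarrow> nat" where
  "Curl A \<theta> = (LEAST N. N \<ge> 1 \<and> Per (free_group A) \<theta> = Fix (free_group A) (\<theta> ^^ N))"

text \<open>The value is independent of the chosen preimage \<open>u\<close>, see \<open>induced_fim_to_fg\<close> below.\<close>

definition induced :: "'a set \<Rightarrow> ('a word set \<Rightarrow> 'a word set) \<Rightarrow> 'a word set \<Rightarrow> 'a word set" where
  "induced A \<phi> g =
     (THE h. \<exists>u \<in> carrier (free_inverse_monoid A). g = fim_to_fg A u \<and> h = fim_to_fg A (\<phi> u))"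

definition Rad :: "'a set \<Rightarrow> nat \<Rightarrow> ('a word set \<Rightarrow> 'a word set) \<Rightarrow> 'a word set set" where
  "Rad A n \<phi> =
     {u \<in> Fix (free_inverse_monoid A) (\<phi> ^^ n).
        fim_to_fg A u \<in> Fix (free_group A) (induced A \<phi>)}"


section \<open>Context-free languages and subsets\<close>

datatype ('n, 't) sym = Nt 'n | Tm 't

type_synonym ('n, 't) prods = "('n \<times> ('n, 't) sym list) set"

inductive derives1 :: "('n, 't) prods \<Rightarrow> ('n, 't) sym list \<Rightarrow> ('n, 't) sym list \<Rightarrow> bool"
  for P :: "('n, 't) prods" where
  "(B, w) \<in> P \<Longrightarrow> derives1 P (u @ [Nt B] @ v) (u @ w @ v)"

definition Lang :: "('n, 't) prods \<Rightarrow> 'n \<Rightarrow> 't list set" where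
  "Lang P S = {w. (derives1 P)\<^sup>*\<^sup>* [Nt S] (map Tm w)}"

text \<open>A finite set of productions involves finitely many nonterminals, so taking them from
  \<open>nat\<close> loses no generality.\<close>

definition context_free :: "'t list set \<Rightarrow> bool" where
  "context_free L \<longleftrightarrow> (\<exists>(P :: (nat, 't) prods) S. finite P \<and> L = Lang P S)"

definition context_free_subset :: "'a set \<Rightarrow> 'a word set set \<Rightarrow> bool" where
  "context_free_subset A X \<longleftrightarrow> (\<exists>L. L \<subseteq> words A \<and> context_free L \<and> X = fim_proj A ` L)"


section \<open>Well-definedness\<close>

lemma gen_cong_equiv:
  assumes "R \<subseteq> words A \<times> words A"
  shows "equiv (words A) (gen_cong A R)"
proof -
  have dom: "u \<in> words A \<and> v \<in> words A" if "(u, v) \<in> gen_cong A R" for u v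
    using that by (induction rule: gen_cong.induct) (use assms in auto)
  show ?thesis
  proof (intro equivI refl_onI symI transI)
    show "gen_cong A R \<subseteq> words A \<times> words A" using dom by (simp add: subset_iff)
  qed (rule gen_cong.refl gen_cong.sym gen_cong.trans; assumption)+
qed

lemma fim_rels_subset: "fim_rels A \<subseteq> words A \<times> words A"
  by (auto simp: fim_rels_def)

lemma fg_rels_subset: "fg_rels A \<subseteq> words A \<times> words A"
  by (auto simp: fg_rels_def words_def)

lemma equiv_fim: "equiv (words A) (fim_cong A)"
  unfolding fim_cong_def by (rule gen_cong_equiv[OF fim_rels_subset])

lemma equiv_fg: "equiv (words A) (fg_cong A)"
  unfolding fg_cong_def by (rule gen_cong_equiv[OF fg_rels_subset])

lemma quot_mult:
  assumes R: "R \<subseteq> words A \<times> words A" and uv: "u \<in> words A" "v \<in> words A"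
  shows "(gen_cong A R `` {u}) \<otimes>\<^bsub>quot_monoid A (gen_cong A R)\<^esub> (gen_cong A R `` {v})
         = gen_cong A R `` {u @ v}"
proof -
  note E = gen_cong_equiv[OF R]
  have *: "gen_cong A R `` {x @ y} = gen_cong A R `` {u @ v}"
    if "(u, x) \<in> gen_cong A R" "(v, y) \<in> gen_cong A R" for x y
    using equiv_class_eq[OF E gen_cong.mult[OF that]] by simp
  have ne: "gen_cong A R `` {u} \<noteq> {}" "gen_cong A R `` {v} \<noteq> {}"
    using gen_cong.refl[OF uv(1), of R] gen_cong.refl[OF uv(2), of R] by blast+
  have "(\<Union>x\<in>gen_cong A R `` {u}. \<Union>y\<in>gen_cong A R `` {v}. gen_cong A R `` {x @ y})
      = (\<Union>x\<in>gen_cong A R `` {u}. \<Union>y\<in>gen_cong A R `` {v}. gen_cong A R `` {u @ v})"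
    by (rule SUP_cong[OF HOL.refl], rule SUP_cong[OF HOL.refl], rule *) simp_all
  also have "\<dots> = gen_cong A R `` {u @ v}"
    using ne by (simp only: UN_constant if_False)
  finally show ?thesis by (simp add: quot_monoid_def)
qed

lemma quot_carrierE:
  assumes "X \<in> carrier (quot_monoid A r)"
  obtains u where "u \<in> words A" "X = r `` {u}"
  using assms by (auto simp: quot_monoid_def elim: quotientE)

lemma quot_class_in: "u \<in> words A \<Longrightarrow> r `` {u} \<in> carrier (quot_monoid A r)"
  by (simp add: quot_monoid_def quotientI)

lemma quot_one: "\<one>\<^bsub>quot_monoid A r\<^esub> = r `` {[]}"
  by (simp add: quot_monoid_def)

lemma quot_is_monoid:
  assumes R: "R \<subseteq> words A \<times> words A"
  shows "monoid (quot_monoid A (gen_cong A R))"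
  by (rule monoidI)
    (auto elim!: quot_carrierE simp: quot_one quot_mult[OF R] intro!: quot_class_in)

lemma fim_is_monoid: "monoid (free_inverse_monoid A)"
  unfolding free_inverse_monoid_def fim_cong_def by (rule quot_is_monoid[OF fim_rels_subset])

lemma fg_word_inv:
  "u \<in> words A \<Longrightarrow> (u @ word_inv u, []) \<in> fg_cong A"
proof (induction u)
  case Nil
  then show ?case by (simp add: fg_cong_def gen_cong.refl)
next
  case (Cons x u)
  then have x: "x \<in> Gen ` A \<union> Inv ` A" and u: "u \<in> words A"
    by (auto simp: words_def)
  have ws: "[x] \<in> words A" "[letter_inv x] \<in> words A"
    using x letter_inv_in[OF x] by (simp_all add: words_def)
  have "(([x] @ (u @ word_inv u)) @ [letter_inv x], ([x] @ []) @ [letter_inv x]) \<in> fg_cong A"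
    using Cons.IH[OF u] ws unfolding fg_cong_def
    by (intro gen_cong.mult gen_cong.refl)
  moreover have "(([x] @ []) @ [letter_inv x], []) \<in> fg_cong A"
    using x unfolding fg_cong_def by (intro gen_cong.base) (auto simp: fg_rels_def)
  ultimately have "(([x] @ (u @ word_inv u)) @ [letter_inv x], []) \<in> fg_cong A"
    unfolding fg_cong_def by (rule gen_cong.trans)
  then show ?case by (simp add: word_inv_def)
qed

lemma fg_is_group: "group (free_group A)"
proof -
  interpret monoid "free_group A"
    unfolding free_group_def fg_cong_def by (rule quot_is_monoid[OF fg_rels_subset])
  have "\<exists>Y\<in>carrier (free_group A). Y \<otimes>\<^bsub>free_group A\<^esub> X = \<one>\<^bsub>free_group A\<^esub>"
    if X: "X \<in> carrier (free_group A)" for X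
  proof -
    obtain u where u: "u \<in> words A" "X = fg_cong A `` {u}"
      using X unfolding free_group_def by (rule quot_carrierE)
    let ?Y = "fg_cong A `` {word_inv u}"
    have "?Y \<otimes>\<^bsub>free_group A\<^esub> X = fg_cong A `` {word_inv u @ u}"
      unfolding u(2) free_group_def fg_cong_def
      by (rule quot_mult[OF fg_rels_subset]) (use u in auto)
    also have "\<dots> = fg_cong A `` {[]}"
      using fg_word_inv[of "word_inv u" A] u(1) by (intro equiv_class_eq[OF equiv_fg]) auto
    finally show ?thesis
      using quot_class_in[of "word_inv u" A "fg_cong A"] u(1)
      by (auto simp: free_group_def quot_one)
  qed
  then show ?thesis by (intro group_l_invI) auto
qed

lemma fim_cong_le_fg_cong: "(u, v) \<in> fim_cong A \<Longrightarrow> (u, v) \<in> fg_cong A"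
  unfolding fim_cong_def
proof (induction rule: gen_cong.induct)
  case (base u v)
  have cancel: "(u @ word_inv u @ w, w) \<in> fg_cong A" if "u \<in> words A" "w \<in> words A" for u w
    using gen_cong.mult[OF fg_word_inv[OF that(1), unfolded fg_cong_def] gen_cong.refl[OF that(2)]]
    by (simp add: fg_cong_def)
  from base show ?case
    unfolding fim_rels_def
  proof (elim UnE CollectE exE conjE, goal_cases)
    case (1 w)
    then show ?case using cancel[of w w] by simp
  next
    case (2 x y)
    then have xy: "x \<in> words A" "y \<in> words A" by simp_all
    have nil: "(p @ word_inv p @ q @ word_inv q, []) \<in> gen_cong A (fg_rels A)"
      if "p \<in> words A" "q \<in> words A" for p q
    proof (rule gen_cong.trans)
      show "(p @ word_inv p @ q @ word_inv q, q @ word_inv q) \<in> gen_cong A (fg_rels A)"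
        using cancel[of p "q @ word_inv q"] that unfolding fg_cong_def by simp
      show "(q @ word_inv q, []) \<in> gen_cong A (fg_rels A)"
        using fg_word_inv[OF that(2)] unfolding fg_cong_def .
    qed
    show ?case
      using gen_cong.trans[OF nil[OF xy] gen_cong.sym[OF nil[OF xy(2,1)]]] 2
      by (simp add: fg_cong_def)
  qed
next
  case (refl u)
  then show ?case by (simp add: fg_cong_def gen_cong.refl)
next
  case (sym u v)
  show ?case using gen_cong.sym sym.IH unfolding fg_cong_def by blast
next
  case (trans u v w)
  show ?case using gen_cong.trans trans.IH unfolding fg_cong_def by blast
next
  case (mult u v s t)
  show ?case using gen_cong.mult mult.IH unfolding fg_cong_def by blast
qed

lemma fim_to_fg_proj:
  assumes "u \<in> words A"
  shows "fim_to_fg A (fim_proj A u) = fg_cong A `` {u}"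
proof -
  have *: "fg_cong A `` {v} = fg_cong A `` {u}" if "(u, v) \<in> fim_cong A" for v
    using equiv_class_eq[OF equiv_fg fim_cong_le_fg_cong[OF that]] by simp
  have ne: "fim_cong A `` {u} \<noteq> {}"
    using gen_cong.refl[OF assms, of "fim_rels A"] by (simp only: fim_cong_def) blast
  have "(\<Union>v\<in>fim_cong A `` {u}. fg_cong A `` {v})
      = (\<Union>v\<in>fim_cong A `` {u}. fg_cong A `` {u})"
    by (rule SUP_cong[OF HOL.refl], rule *) simp
  also have "\<dots> = fg_cong A `` {u}"
    using ne by (simp only: UN_constant if_False)
  finally show ?thesis by (simp only: fim_to_fg_def fim_proj_def)
qed

lemma fim_carrierE:
  assumes "X \<in> carrier (free_inverse_monoid A)"
  obtains u where "u \<in> words A" "X = fim_proj A u"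
  using assms unfolding free_inverse_monoid_def fim_proj_def by (rule quot_carrierE)

lemma fim_proj_in: "u \<in> words A \<Longrightarrow> fim_proj A u \<in> carrier (free_inverse_monoid A)"
  by (simp add: free_inverse_monoid_def fim_proj_def quot_class_in)

lemma fim_proj_append:
  "u \<in> words A \<Longrightarrow> v \<in> words A \<Longrightarrow>
   fim_proj A (u @ v) = fim_proj A u \<otimes>\<^bsub>free_inverse_monoid A\<^esub> fim_proj A v"
  unfolding fim_proj_def free_inverse_monoid_def fim_cong_def
  by (rule quot_mult[OF fim_rels_subset, symmetric])

lemma fim_proj_Nil: "fim_proj A [] = \<one>\<^bsub>free_inverse_monoid A\<^esub>"
  by (simp add: fim_proj_def free_inverse_monoid_def quot_one)

lemma fim_to_fg_hom: "fim_to_fg A \<in> hom (free_inverse_monoid A) (free_group A)"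
proof (rule homI)
  fix X assume "X \<in> carrier (free_inverse_monoid A)"
  then show "fim_to_fg A X \<in> carrier (free_group A)"
    by (auto elim!: fim_carrierE simp: fim_to_fg_proj free_group_def intro: quot_class_in)
next
  fix X Y assume "X \<in> carrier (free_inverse_monoid A)" "Y \<in> carrier (free_inverse_monoid A)"
  then obtain u v where uv: "u \<in> words A" "X = fim_proj A u" "v \<in> words A" "Y = fim_proj A v"
    by (auto elim!: fim_carrierE)
  then show "fim_to_fg A (X \<otimes>\<^bsub>free_inverse_monoid A\<^esub> Y)
      = fim_to_fg A X \<otimes>\<^bsub>free_group A\<^esub> fim_to_fg A Y"
    using quot_mult[OF fg_rels_subset, of u A v]
    by (simp add: fim_proj_append[symmetric] fim_to_fg_proj free_group_def fg_cong_def)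
qed

lemma fim_to_fg_surj:
  "fim_to_fg A ` carrier (free_inverse_monoid A) = carrier (free_group A)"
proof
  show "fim_to_fg A ` carrier (free_inverse_monoid A) \<subseteq> carrier (free_group A)"
    using fim_to_fg_hom by (auto simp: hom_def)
  show "carrier (free_group A) \<subseteq> fim_to_fg A ` carrier (free_inverse_monoid A)"
  proof
    fix g assume "g \<in> carrier (free_group A)"
    then obtain u where "u \<in> words A" "g = fg_cong A `` {u}"
      unfolding free_group_def by (rule quot_carrierE)
    then show "g \<in> fim_to_fg A ` carrier (free_inverse_monoid A)"
      by (metis fim_to_fg_proj fim_proj_in imageI)
  qed
qed

lemma endo_respects_fg_cong:
  assumes \<phi>: "\<phi> \<in> monoid_End (free_inverse_monoid A)"
    and uv: "(u, v) \<in> fg_cong A"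
  shows "fim_to_fg A (\<phi> (fim_proj A u)) = fim_to_fg A (\<phi> (fim_proj A v))"
proof -
  let ?M = "free_inverse_monoid A" and ?F = "free_group A"
  interpret F: group ?F by (rule fg_is_group)
  define f where "f u = fim_to_fg A (\<phi> (fim_proj A u))" for u
  have hom: "\<phi> \<in> hom ?M ?M" and one: "\<phi> \<one>\<^bsub>?M\<^esub> = \<one>\<^bsub>?M\<^esub>"
    using \<phi> by (auto simp: monoid_End_def)
  have f_in: "f u \<in> carrier ?F" if "u \<in> words A" for u
    using hom fim_to_fg_hom[of A] fim_proj_in[OF that] by (auto simp: f_def hom_def)
  have f_app: "f (u @ v) = f u \<otimes>\<^bsub>?F\<^esub> f v" if "u \<in> words A" "v \<in> words A" for u v
    using hom fim_to_fg_hom[of A] fim_proj_in[OF that(1)] fim_proj_in[OF that(2)]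
    by (simp add: f_def fim_proj_append[OF that] hom_mult hom_in_carrier)
  have "f [] \<otimes>\<^bsub>?F\<^esub> f [] = f []"
    using f_app[of "[]" "[]"] by simp
  then have f_Nil: "f [] = \<one>\<^bsub>?F\<^esub>"
    using f_in[of "[]"] by (simp add: F.l_cancel_one)
  have dom: "u \<in> words A \<and> v \<in> words A" if "(u, v) \<in> fg_cong A" for u v
    using that equiv_fg[of A] by (auto simp: equiv_def refl_on_def)
  have "f u = f v"
    using uv unfolding fg_cong_def
  proof (induction rule: gen_cong.induct)
    case (base u v)
    then obtain x where x: "u = [x] @ [letter_inv x]" "v = []" "x \<in> Gen ` A \<union> Inv ` A"
      by (auto simp: fg_rels_def)
    have ws: "[x] \<in> words A" "[letter_inv x] \<in> words A"
      using x(3) letter_inv_in[OF x(3)] by (simp_all add: words_def)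
    have wx: "[x] @ [letter_inv x] \<in> words A"
      using ws unfolding append_in_words by blast
    have "(([x] @ [letter_inv x]) @ [x], [x]) \<in> fim_cong A"
      unfolding fim_cong_def
      by (rule gen_cong.base) (use ws in \<open>auto simp: fim_rels_def word_inv_def\<close>)
    then have "f (([x] @ [letter_inv x]) @ [x]) = f [x]"
      unfolding f_def fim_proj_def by (simp only: equiv_class_eq[OF equiv_fim])
    then have "f ([x] @ [letter_inv x]) \<otimes>\<^bsub>?F\<^esub> f [x] = f [x]"
      unfolding f_app[OF wx ws(1)] .
    then have "f ([x] @ [letter_inv x]) = \<one>\<^bsub>?F\<^esub>"
      using F.r_cancel_one[OF f_in[OF ws(1)] f_in[OF wx]] by blast
    then show ?case using f_Nil x by simp
  next
    case (mult u v s t)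
    then show ?case
      using dom[of u v] dom[of s t] by (simp add: f_app fg_cong_def)
  qed auto
  then show ?thesis by (simp add: f_def)
qed

theorem induced_fim_to_fg:
  assumes \<phi>: "\<phi> \<in> monoid_End (free_inverse_monoid A)"
    and X: "X \<in> carrier (free_inverse_monoid A)"
  shows "induced A \<phi> (fim_to_fg A X) = fim_to_fg A (\<phi> X)"
  unfolding induced_def
proof (rule the_equality)
  show "\<exists>u\<in>carrier (free_inverse_monoid A).
      fim_to_fg A X = fim_to_fg A u \<and> fim_to_fg A (\<phi> X) = fim_to_fg A (\<phi> u)"
    using X by blast
next
  fix h
  assume "\<exists>u\<in>carrier (free_inverse_monoid A).
      fim_to_fg A X = fim_to_fg A u \<and> h = fim_to_fg A (\<phi> u)"
  then obtain Y where Y: "Y \<in> carrier (free_inverse_monoid A)"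
      "fim_to_fg A X = fim_to_fg A Y" "h = fim_to_fg A (\<phi> Y)" by blast
  obtain u where u: "u \<in> words A" "X = fim_proj A u" using X by (rule fim_carrierE)
  obtain v where v: "v \<in> words A" "Y = fim_proj A v" using Y(1) by (rule fim_carrierE)
  have "(u, v) \<in> fg_cong A"
    using Y(2) u v eq_equiv_class_iff[OF equiv_fg u(1) v(1)] by (simp add: fim_to_fg_proj)
  then show "h = fim_to_fg A (\<phi> X)"
    using endo_respects_fg_cong[OF \<phi>] u v Y(3) by simp
qed

end

theory Submission
  imports Defs
begin

text \<open>By Munn's theorem (\<open>fim_proj_eq_iff\<close>), an element of the free inverse monoid is a pair of a
  finite subtree of the Cayley tree of the free group, which contains the root, and a vertex of this
  subtree, the image of the element in the free group. Let \<open>N\<close> be the curl of the endomorphism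
  \<open>\<theta>\<close> induced on the free group and let \<open>\<psi> = \<phi>\<^sup>N\<close>. The radical consists of the fixed points of \<open>\<psi>\<close>
  whose image is fixed by \<open>\<theta>\<close>.

  The fixed points of \<open>\<psi>\<close> form a finitely generated monoid
  (\<open>fixed_points_finitely_generated\<close>). If \<open>x\<^sub>1 \<dots> x\<^sub>n\<close> is fixed, then all images of \<open>x\<^sub>i\<close> under powers of
  \<open>\<psi>\<close> are factors of \<open>x\<^sub>1 \<dots> x\<^sub>n\<close>, so there are only finitely many of them. For a letter \<open>x\<close> with this
  property, the images \<open>\<psi>\<^sup>j x\<close> are eventually periodic, and by the choice of \<open>N\<close> their images in the
  free group are eventually constant. Hence the recurrent ones among the \<open>\<psi>\<^sup>j x\<close> have a meet, the pair
  of the union of their trees and their common vertex. This meet is fixed by \<open>\<psi>\<close>, which permutes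
  the trees. The meets for the finitely many such letters generate, because \<open>x\<^sub>1 \<dots> x\<^sub>n = \<psi>\<^sup>j (x\<^sub>1) \<dots> \<psi>\<^sup>j (x\<^sub>n)\<close>
  for all \<open>j\<close>.

  It remains to see that the words over a finite set of words whose image is fixed by \<open>\<theta>\<close> form a
  context-free language (\<open>context_free_star_fixed\<close>). By an argument of Goldstein and Turner
  (\<open>finite_defects\<close>), the reduced words that represent fixed points of \<open>\<theta>\<close> are read by a finite
  automaton, and a context-free grammar can check that a word is read by one finite automaton and
  its reduction by another (\<open>context_free_run_red\<close>).

  That the curl is a period at all, and not the minimum of an empty set, needs a proof
  (\<open>common_period\<close>). Some power of \<open>\<theta>\<close> is idempotent on letter counts modulo 6. Such
  an endomorphism is close to idempotent on the polynomial functions from the free group to the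
  integers modulo 2 or modulo 3, which forces the periods of these functions along a periodic orbit
  to be powers of 2 or of 3, respectively. As polynomial functions separate points, the
  orbit has a period that is a power of 2 and one that is a power of 3, so it is a fixed point.\<close>



section \<open>Free reduction\<close>

definition letters :: "'a set \<Rightarrow> 'a letter set" where
  "letters A = Gen ` A \<union> Inv ` A"

lemma words_iff: "w \<in> words A \<longleftrightarrow> set w \<subseteq> letters A"
  by (auto simp: words_def letters_def)

lemma words_Cons [simp]: "x # w \<in> words A \<longleftrightarrow> x \<in> letters A \<and> w \<in> words A"
  by (auto simp: words_iff)

lemma letter_inv_in_letters [simp]: "letter_inv x \<in> letters A \<longleftrightarrow> x \<in> letters A"
  by (cases x) (auto simp: letters_def)

lemma finite_letters: "finite A \<Longrightarrow> finite (letters A)"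
  by (simp add: letters_def)

lemma letter_inv_neq [simp]: "letter_inv x \<noteq> x" "x \<noteq> letter_inv x"
  by (cases x; simp)+

lemma letter_inv_eq_iff [simp]: "letter_inv x = letter_inv y \<longleftrightarrow> x = y"
  by (metis letter_inv_letter_inv)

lemma word_inv_Cons [simp]: "word_inv (x # w) = word_inv w @ [letter_inv x]"
  by (simp add: word_inv_def)

definition reduced :: "'a word \<Rightarrow> bool" where
  "reduced w \<longleftrightarrow> successively (\<lambda>x y. y \<noteq> letter_inv x) w"

lemma reduced_Nil [simp]: "reduced []"
  and reduced_single [simp]: "reduced [x]"
  and reduced_Cons2: "reduced (x # y # w) \<longleftrightarrow> y \<noteq> letter_inv x \<and> reduced (y # w)"
  by (auto simp: reduced_def)

lemma reduced_appendD: "reduced (u @ v) \<Longrightarrow> reduced u \<and> reduced v"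
  by (simp add: reduced_def successively_append_iff)

lemma reduced_ConsD: "reduced (x # w) \<Longrightarrow> reduced w"
  using reduced_appendD[of "[x]" w] by simp

lemma reduced_snoc: "reduced (w @ [x]) \<longleftrightarrow> reduced w \<and> (w = [] \<or> last w \<noteq> letter_inv x)"
  by (auto simp: reduced_def successively_append_iff)

fun push :: "'a letter \<Rightarrow> 'a word \<Rightarrow> 'a word" where
  "push x [] = [x]"
| "push x (y # w) = (if y = letter_inv x then w else x # y # w)"

text \<open>The left translation of the Cayley tree of the free group, whose vertices are the reduced
  words, by the group element that the word \<open>u\<close> represents.\<close>

definition act :: "'a word \<Rightarrow> 'a word \<Rightarrow> 'a word" where
  "act u r = foldr push u r"

definition red :: "'a word \<Rightarrow> 'a word" where
  "red u = act u []"

lemma act_Nil [simp]: "act [] r = r"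
  and act_Cons [simp]: "act (x # u) r = push x (act u r)"
  and act_append [simp]: "act (u @ v) r = act u (act v r)"
  by (simp_all add: act_def)

lemma red_Nil [simp]: "red [] = []"
  and red_Cons: "red (x # u) = push x (red u)"
  and red_append: "red (u @ v) = act u (red v)"
  by (simp_all add: red_def)

lemma reduced_push: "reduced r \<Longrightarrow> reduced (push x r)"
  by (cases r) (auto simp: reduced_Cons2 dest: reduced_ConsD)

lemma reduced_act [simp]: "reduced r \<Longrightarrow> reduced (act u r)"
  by (induction u) (auto intro: reduced_push)

lemma reduced_red [simp]: "reduced (red u)"
  by (simp add: red_def)

lemma push_inv [simp]: "reduced r \<Longrightarrow> push (letter_inv x) (push x r) = r"
  by (cases r; cases "tl r") (auto simp: reduced_Cons2)

lemma push_inv' [simp]: "reduced r \<Longrightarrow> push x (push (letter_inv x) r) = r"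
  using push_inv[of r "letter_inv x"] by simp

lemma act_inv [simp]: "reduced r \<Longrightarrow> act (word_inv u) (act u r) = r"
  by (induction u arbitrary: r) auto

lemma act_inv' [simp]: "reduced r \<Longrightarrow> act u (act (word_inv u) r) = r"
  using act_inv[of r "word_inv u"] by simp

lemma push_reduced: "reduced (x # r) \<Longrightarrow> push x r = x # r"
  by (cases r) (auto simp: reduced_Cons2)

lemma red_reduced [simp]: "reduced w \<Longrightarrow> red w = w"
  by (induction w) (use push_reduced reduced_ConsD in \<open>fastforce simp: red_Cons\<close>)+

lemma act_push: "reduced r \<Longrightarrow> act (push x u) r = push x (act u r)"
  by (cases u) auto

lemma act_red [simp]: "reduced r \<Longrightarrow> act (red u) r = act u r"
  by (induction u) (auto simp: red_Cons act_push)

lemma act_cong: "red u = red v \<Longrightarrow> reduced r \<Longrightarrow> act u r = act v r"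
  by (metis act_red)

lemma red_cong: "red u = red u' \<Longrightarrow> red v = red v' \<Longrightarrow> red (u @ v) = red (u' @ v')"
  by (simp add: red_append act_cong[of u u'])

lemma red_red_append [simp]: "red (red u @ v) = red (u @ v)" "red (u @ red v) = red (u @ v)"
  by (simp_all add: red_append)

lemma red_word_inv_cong:
  assumes "red u = red v"
  shows "red (word_inv u) = red (word_inv v)"
proof -
  have "red (word_inv u) = act (word_inv u) (act v (act (word_inv v) []))"
    by (simp add: red_def)
  also have "\<dots> = act (word_inv u) (act u (act (word_inv v) []))"
    using act_cong[OF assms] by simp
  finally show ?thesis by (simp add: red_def)
qed

lemma red_inv_left [simp]: "red (word_inv u @ u) = []"
  and red_inv_right [simp]: "red (u @ word_inv u) = []"
  by (simp_all add: red_def)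

lemma red_eqI_inv: "red (word_inv u @ v) = [] \<Longrightarrow> red u = red v"
  by (metis act_inv' append_Nil2 red_append red_def reduced_red)

lemma set_push: "set (push x r) \<subseteq> insert x (set r)"
  by (cases r) auto

lemma set_act: "set (act u r) \<subseteq> set u \<union> set r"
  using set_push by (induction u) fastforce+

lemma red_in_words [simp]: "u \<in> words A \<Longrightarrow> red u \<in> words A"
  using set_act[of u "[]"] by (auto simp: words_iff red_def)

lemma length_push: "length (push x r) \<le> Suc (length r)"
  by (cases r) auto

lemma length_act: "length (act u r) \<le> length u + length r"
proof (induction u)
  case (Cons x u)
  then show ?case using length_push[of x "act u r"] by simp
qed simp

lemma length_red: "length (red u) \<le> length u"
  using length_act[of u "[]"] by (simp add: red_def)

lemma red_single_cancel [simp]: "red (letter_inv x # x # w) = red w"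
  by (simp add: red_Cons)

lemma fg_congI_red: "u \<in> words A \<Longrightarrow> (u, red u) \<in> fg_cong A"
proof (induction u)
  case Nil
  then show ?case by (simp add: fg_cong_def gen_cong.refl)
next
  case (Cons x u)
  then have x: "x \<in> letters A" and u: "u \<in> words A" by (auto simp: words_iff)
  have xw: "[x] \<in> words A" using x by (simp add: words_iff)
  have 1: "([x] @ u, [x] @ red u) \<in> fg_cong A"
    using Cons.IH[OF u] xw unfolding fg_cong_def by (intro gen_cong.mult gen_cong.refl)
  have 2: "([x] @ red u, red (x # u)) \<in> fg_cong A"
  proof (cases "\<exists>t. red u = letter_inv x # t")
    case True
    then obtain t where t: "red u = letter_inv x # t" by blast
    then have tw: "t \<in> words A" using red_in_words[OF u] by (auto simp: words_iff)
    have "([x, letter_inv x] @ t, [] @ t) \<in> fg_cong A"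
      unfolding fg_cong_def using tw x
      by (intro gen_cong.mult gen_cong.refl gen_cong.base) (auto simp: fg_rels_def letters_def)
    then show ?thesis by (simp add: red_Cons t)
  next
    case False
    then have "red (x # u) = [x] @ red u" by (cases "red u") (auto simp: red_Cons)
    moreover have "[x] @ red u \<in> words A"
      using xw red_in_words[OF u] unfolding append_in_words by blast
    ultimately show ?thesis by (simp add: fg_cong_def gen_cong.refl)
  qed
  show ?case using gen_cong.trans[OF 1[unfolded fg_cong_def] 2[unfolded fg_cong_def]]
    by (simp add: fg_cong_def)
qed

lemma fg_cong_in_words: "(u, v) \<in> fg_cong A \<Longrightarrow> u \<in> words A \<and> v \<in> words A"
  using equiv_fg[of A] by (auto simp: equiv_def refl_on_def)

text \<open>The relations hold for the action on reduced words, in which a letter and its inverse act as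
  mutually inverse maps.\<close>

lemma fg_cong_iff_red:
  "(u, v) \<in> fg_cong A \<longleftrightarrow> u \<in> words A \<and> v \<in> words A \<and> red u = red v"
proof
  have "red u = red v" if "(u, v) \<in> fg_cong A" using that unfolding fg_cong_def
  proof (induction rule: gen_cong.induct)
    case (base u v)
    then show ?case by (auto simp: fg_rels_def red_Cons)
  next
    case (mult u v s t)
    then show ?case by (blast intro: red_cong)
  qed auto
  then show "(u, v) \<in> fg_cong A \<Longrightarrow> u \<in> words A \<and> v \<in> words A \<and> red u = red v"
    using fg_cong_in_words by blast
  show "(u, v) \<in> fg_cong A" if "u \<in> words A \<and> v \<in> words A \<and> red u = red v"
    using that fg_congI_red[of u A] gen_cong.trans[OF _ gen_cong.sym[OF fg_congI_red[of v A, unfolded fg_cong_def]]]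
    unfolding fg_cong_def by fastforce
qed

lemma fg_class_eq_iff:
  "u \<in> words A \<Longrightarrow> v \<in> words A \<Longrightarrow> fg_cong A `` {u} = fg_cong A `` {v} \<longleftrightarrow> red u = red v"
  using eq_equiv_class_iff[OF equiv_fg, of u A v] by (simp add: fg_cong_iff_red)


section \<open>Munn trees\<close>

text \<open>The vertices of the subtree of the Cayley tree that is traversed when \<open>u\<close> is read from the
  root. As a subtree is determined by its vertices, edges are not recorded.\<close>

fun munn :: "'a word \<Rightarrow> 'a word set" where
  "munn [] = {[]}"
| "munn (x # u) = insert [] (push x ` munn u)"

lemma finite_munn [simp]: "finite (munn u)"
  by (induction u) auto

lemma Nil_in_munn [simp]: "[] \<in> munn u"
  by (cases u) auto

lemma reduced_munn: "r \<in> munn u \<Longrightarrow> reduced r"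
  by (induction u arbitrary: r) (auto intro: reduced_push)

lemma munn_append: "munn (u @ v) = munn u \<union> act u ` munn v"
  by (induction u) (auto simp: image_Un image_image insert_absorb)

lemma red_in_munn: "red u \<in> munn u"
  by (induction u) (auto simp: red_Cons)

lemma act_act_inv_munn [simp]: "act u ` act (word_inv u) ` munn v = munn v"
  by (auto simp: image_image reduced_munn cong: image_cong)

lemma munn_word_inv: "munn (word_inv u) = act (word_inv u) ` munn u"
proof (induction u)
  case (Cons x u)
  have "push (letter_inv x) ` push x ` munn u = munn u"
    by (auto simp: image_image reduced_munn cong: image_cong)
  then have "push (letter_inv x) ` munn (x # u) = munn u \<union> munn [letter_inv x]"
    by (auto simp: insert_absorb)
  then have "act (word_inv u) ` push (letter_inv x) ` munn (x # u) = munn (word_inv (x # u))"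
    by (simp only: word_inv_Cons munn_append Cons image_Un)
  then show ?case by (simp add: image_image)
qed simp

lemma munn_idem [simp]: "munn (u @ word_inv u) = munn u"
  by (simp add: munn_append munn_word_inv)

lemma munn_idem_append [simp]: "munn (u @ word_inv u @ v) = munn u \<union> munn v"
  using munn_append[of "u @ word_inv u" v] by (simp add: image_image reduced_munn cong: image_cong)

lemma act_munn_cong: "red u = red u' \<Longrightarrow> act u ` munn v = act u' ` munn v"
  by (intro image_cong[OF HOL.refl] act_cong reduced_munn)

lemma munn_append_cong:
  "munn u = munn u' \<Longrightarrow> red u = red u' \<Longrightarrow> munn v = munn v' \<Longrightarrow> munn (u @ v) = munn (u' @ v')"
  using act_munn_cong[of u u' v'] by (simp add: munn_append)

lemma fim_cong_imp_munn: "(u, v) \<in> fim_cong A \<Longrightarrow> munn u = munn v"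
proof -
  assume uv: "(u, v) \<in> fim_cong A"
  have "munn u = munn v \<and> red u = red v" using uv unfolding fim_cong_def
  proof (induction rule: gen_cong.induct)
    case (base u v)
    then show ?case by (auto simp: fim_rels_def red_def)
  next
    case (mult u v s t)
    then have "munn s = munn t" "munn u = munn v" "red u = red v" by auto
    then have "munn (u @ s) = munn (v @ t)" by (intro munn_append_cong)
    then show ?case using mult red_cong by blast
  qed auto
  then show ?thesis by simp
qed

lemma fim_proj_eqD:
  assumes "u \<in> words A" "v \<in> words A" "fim_proj A u = fim_proj A v"
  shows "munn u = munn v \<and> red u = red v"
proof -
  have "(u, v) \<in> fim_cong A"
    using assms eq_equiv_class_iff[OF equiv_fim assms(1,2)] by (simp add: fim_proj_def)
  then show ?thesis using fim_cong_imp_munn fim_cong_le_fg_cong fg_cong_iff_red by metis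
qed

lemma fim_proj_sandwich:
  assumes "fim_proj A u = fim_proj A v" "a \<in> words A" "b \<in> words A" "u \<in> words A" "v \<in> words A"
  shows "fim_proj A (a @ u @ b) = fim_proj A (a @ v @ b)"
  using assms by (simp add: fim_proj_append)

lemma fim_proj_base: "(u, v) \<in> fim_rels A \<Longrightarrow> fim_proj A u = fim_proj A v"
  unfolding fim_proj_def fim_cong_def
  by (intro equiv_class_eq[OF gen_cong_equiv[OF fim_rels_subset]] gen_cong.base)

lemma fim_proj_regular: "u \<in> words A \<Longrightarrow> fim_proj A (u @ word_inv u @ u) = fim_proj A u"
  by (rule fim_proj_base) (auto simp: fim_rels_def)

lemma fim_proj_commute:
  "u \<in> words A \<Longrightarrow> v \<in> words A \<Longrightarrow>
   fim_proj A (u @ word_inv u @ v @ word_inv v) = fim_proj A (v @ word_inv v @ u @ word_inv u)"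
  by (rule fim_proj_base) (auto simp: fim_rels_def)

definition idems :: "'a word list \<Rightarrow> 'a word" where
  "idems l = concat (map (\<lambda>v. v @ word_inv v) l)"

lemma idems_simps [simp]:
  "idems [] = []" "idems (v # l) = v @ word_inv v @ idems l" "idems (l @ l') = idems l @ idems l'"
  by (simp_all add: idems_def)

lemma idems_in_words [simp]: "set l \<subseteq> words A \<Longrightarrow> idems l \<in> words A"
  by (induction l) auto

lemma idems_commute1:
  assumes "v \<in> words A" "set l \<subseteq> words A"
  shows "fim_proj A (v @ word_inv v @ idems l) = fim_proj A (idems l @ v @ word_inv v)"
  using assms(2)
proof (induction l)
  case (Cons u l)
  then have w: "u \<in> words A" "idems l \<in> words A" by auto
  have "fim_proj A (v @ word_inv v @ idems (u # l))
      = fim_proj A ([] @ (v @ word_inv v @ u @ word_inv u) @ idems l)" by simp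
  also have "\<dots> = fim_proj A ([] @ (u @ word_inv u @ v @ word_inv v) @ idems l)"
    by (rule fim_proj_sandwich[OF fim_proj_commute]) (use w assms in auto)
  also have "\<dots> = fim_proj A ((u @ word_inv u) @ (v @ word_inv v @ idems l) @ [])" by simp
  also have "\<dots> = fim_proj A ((u @ word_inv u) @ (idems l @ v @ word_inv v) @ [])"
    by (rule fim_proj_sandwich[OF Cons.IH]) (use w assms Cons in auto)
  finally show ?case by simp
qed simp

lemma idems_absorb:
  assumes "v \<in> set l" "set l \<subseteq> words A"
  shows "fim_proj A (v @ word_inv v @ idems l) = fim_proj A (idems l)"
  using assms
proof (induction l)
  case (Cons u l)
  then have w: "u \<in> words A" "idems l \<in> words A" "v \<in> words A" by auto
  show ?case
  proof (cases "v = u")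
    case True
    have "fim_proj A ([] @ (v @ word_inv v @ v) @ (word_inv v @ idems l))
        = fim_proj A ([] @ v @ (word_inv v @ idems l))"
      by (rule fim_proj_sandwich[OF fim_proj_regular]) (use w in auto)
    then show ?thesis using True by simp
  next
    case False
    have "fim_proj A (v @ word_inv v @ idems (u # l))
        = fim_proj A ([] @ (v @ word_inv v @ u @ word_inv u) @ idems l)" by simp
    also have "\<dots> = fim_proj A ([] @ (u @ word_inv u @ v @ word_inv v) @ idems l)"
      by (rule fim_proj_sandwich[OF fim_proj_commute]) (use w in auto)
    also have "\<dots> = fim_proj A ((u @ word_inv u) @ (v @ word_inv v @ idems l) @ [])" by simp
    also have "\<dots> = fim_proj A ((u @ word_inv u) @ idems l @ [])"
      by (rule fim_proj_sandwich[OF Cons.IH]) (use w Cons False in auto)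
    finally show ?thesis by simp
  qed
qed simp

lemma idems_absorb_list:
  assumes "set l \<subseteq> set l'" "set l' \<subseteq> words A"
  shows "fim_proj A (idems l @ idems l') = fim_proj A (idems l')"
  using assms(1)
proof (induction l)
  case (Cons v l)
  have "fim_proj A ((v @ word_inv v) @ (idems l @ idems l') @ [])
      = fim_proj A ((v @ word_inv v) @ idems l' @ [])"
    by (rule fim_proj_sandwich[OF Cons.IH]) (use Cons assms in auto)
  then show ?case using idems_absorb[of v l' A] Cons assms by simp
qed simp

lemma idems_commute:
  assumes "set l \<subseteq> words A" "set l' \<subseteq> words A"
  shows "fim_proj A (idems l @ idems l') = fim_proj A (idems l' @ idems l)"
  using assms(1)
proof (induction l)
  case (Cons v l)
  have "fim_proj A ((v @ word_inv v) @ (idems l @ idems l') @ [])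
      = fim_proj A ((v @ word_inv v) @ (idems l' @ idems l) @ [])"
    by (rule fim_proj_sandwich[OF Cons.IH]) (use Cons assms in auto)
  also have "\<dots> = fim_proj A ([] @ (v @ word_inv v @ idems l') @ idems l)" by simp
  also have "\<dots> = fim_proj A ([] @ (idems l' @ v @ word_inv v) @ idems l)"
    by (rule fim_proj_sandwich[OF idems_commute1]) (use Cons assms in auto)
  finally show ?case by simp
qed simp

lemma idems_set_cong:
  assumes "set l = set l'" "set l \<subseteq> words A"
  shows "fim_proj A (idems l) = fim_proj A (idems l')"
  using idems_absorb_list[of l l' A] idems_absorb_list[of l' l A] idems_commute[of l A l'] assms
  by simp

lemma red_snoc_cases:
  obtains (extend) "red (u @ [x]) = red u @ [x]"
  | (cancel) t where "red u = t @ [letter_inv x]" "red (u @ [x]) = t"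
proof (cases "red u = [] \<or> last (red u) \<noteq> letter_inv x")
  case True
  then have "reduced (red u @ [x])" by (simp add: reduced_snoc)
  then have "red (red u @ [x]) = red u @ [x]" by (rule red_reduced)
  then show thesis using extend by simp
next
  case False
  then obtain t where t: "red u = t @ [letter_inv x]"
    by (metis append_butlast_last_id)
  have "red (red u @ [x]) = red (t @ [letter_inv x, x])"
    unfolding t append_assoc append.simps ..
  also have "\<dots> = red t" by (simp add: red_def)
  also have "\<dots> = t" using reduced_appendD[of t] reduced_red[of u] t by simp
  finally have "red (u @ [x]) = t" by (simp only: red_red_append)
  then show thesis using cancel t by blast
qed

text \<open>The induction adds at most one vertex per letter. As the idempotents of the vertices commute,
  this normal form shows that the vertices and the reduction determine the class of a word.\<close>

lemma munn_normal_form: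
  assumes "u \<in> words A"
  shows "\<exists>l. set l = munn u \<and> set l \<subseteq> words A \<and> fim_proj A u = fim_proj A (idems l @ red u)"
  using assms
proof (induction u rule: rev_induct)
  case Nil
  then show ?case by (intro exI[of _ "[[]]"]) simp
next
  case (snoc x u)
  then have u: "u \<in> words A" and x: "[x] \<in> words A" by auto
  obtain l where l: "set l = munn u" "set l \<subseteq> words A"
    and eq: "fim_proj A u = fim_proj A (idems l @ red u)"
    using snoc.IH u by blast
  have lw: "idems l \<in> words A" using l by simp
  define r where "r = red u"
  define r' where "r' = red (u @ [x])"
  have rw: "r \<in> words A" "r' \<in> words A" using u x unfolding r_def r'_def
    by (simp_all only: red_in_words append_in_words simp_thms)
  have set': "set (l @ [r']) = munn (u @ [x])"
    using l red_in_munn[of u] by (auto simp: munn_append r'_def red_def)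
  have lin: "r \<in> set l" using l red_in_munn r_def by metis
  have 1: "fim_proj A (u @ [x]) = fim_proj A (idems l @ (r @ [x]))"
    using fim_proj_sandwich[OF eq, of "[]" "[x]"] u x l rw by (simp add: r_def)
  \<comment> \<open>The two cases come to the same: the idempotent of \<open>r'\<close> can be inserted for free, and if \<open>x\<close>
    cancels, the idempotent of \<open>r\<close>, which is present already, absorbs the detour.\<close>
  have 2: "fim_proj A (idems l @ (r @ [x])) = fim_proj A (idems l @ r')"
  proof (cases rule: red_snoc_cases[of u x])
    case extend
    then show ?thesis by (simp add: r_def r'_def)
  next
    case (cancel t)
    have t: "t = r'" "r = t @ [letter_inv x]" using cancel by (simp_all add: r_def r'_def)
    have tw: "t \<in> words A" "[letter_inv x] \<in> words A" using t rw by auto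
    have "fim_proj A ([] @ (t @ word_inv t @ t) @ [letter_inv x, x])
        = fim_proj A ([] @ t @ [letter_inv x, x])"
      by (rule fim_proj_sandwich[OF fim_proj_regular]) (use tw x in auto)
    moreover have "fim_proj A (t @ (word_inv t @ word_inv (word_inv t)
            @ [letter_inv x] @ word_inv [letter_inv x]) @ [])
        = fim_proj A (t @ ([letter_inv x] @ word_inv [letter_inv x]
            @ word_inv t @ word_inv (word_inv t)) @ [])"
      by (rule fim_proj_sandwich[OF fim_proj_commute]) (use tw x in auto)
    ultimately have "fim_proj A (r @ [x]) = fim_proj A (r @ word_inv r @ t)"
      by (simp add: t)
    then have "fim_proj A (idems l @ (r @ [x]) @ []) = fim_proj A (idems l @ (r @ word_inv r @ t) @ [])"
      by (rule fim_proj_sandwich) (use lw tw x rw in auto)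
    also have "\<dots> = fim_proj A ([] @ (idems l @ r @ word_inv r) @ t)" by simp
    also have "\<dots> = fim_proj A ([] @ (r @ word_inv r @ idems l) @ t)"
      by (rule fim_proj_sandwich[OF idems_commute1[symmetric]]) (use lw tw rw l in auto)
    also have "\<dots> = fim_proj A ([] @ idems l @ t)"
      by (rule fim_proj_sandwich[OF idems_absorb]) (use lw tw rw l lin in auto)
    finally show ?thesis by (simp add: t)
  qed
  have 3: "fim_proj A (idems l @ (r' @ word_inv r' @ r') @ []) = fim_proj A (idems l @ r' @ [])"
    by (rule fim_proj_sandwich[OF fim_proj_regular]) (use rw lw in auto)
  show ?case
  proof (intro exI conjI)
    show "set (l @ [r']) \<subseteq> words A" using l rw by simp
    show "fim_proj A (u @ [x]) = fim_proj A (idems (l @ [r']) @ red (u @ [x]))"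
      using 1 2 3 by (simp add: r'_def)
  qed (rule set')
qed

text \<open>Munn's theorem: the normal forms of two words with the same invariants differ only in the
  order and the multiplicity of commuting idempotents.\<close>

theorem fim_proj_eq_iff:
  assumes "u \<in> words A" "v \<in> words A"
  shows "fim_proj A u = fim_proj A v \<longleftrightarrow> munn u = munn v \<and> red u = red v"
proof
  show "fim_proj A u = fim_proj A v \<Longrightarrow> munn u = munn v \<and> red u = red v"
    by (rule fim_proj_eqD[OF assms])
  assume *: "munn u = munn v \<and> red u = red v"
  obtain l where l: "set l = munn u" "set l \<subseteq> words A" "fim_proj A u = fim_proj A (idems l @ red u)"
    using munn_normal_form[OF assms(1)] by blast
  obtain l' where l': "set l' = munn v" "set l' \<subseteq> words A"
      "fim_proj A v = fim_proj A (idems l' @ red v)"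
    using munn_normal_form[OF assms(2)] by blast
  have "fim_proj A ([] @ idems l @ red u) = fim_proj A ([] @ idems l' @ red u)"
    by (rule fim_proj_sandwich[OF idems_set_cong]) (use * l l' assms in auto)
  then show "fim_proj A u = fim_proj A v" using l l' * by simp
qed


section \<open>Endomorphisms on words\<close>

definition ext :: "('a letter \<Rightarrow> 'a word) \<Rightarrow> 'a word \<Rightarrow> 'a word" where
  "ext F w = concat (map F w)"

lemma ext_simps [simp]:
  "ext F [] = []" "ext F (x # w) = F x @ ext F w" "ext F (u @ v) = ext F u @ ext F v"
  by (simp_all add: ext_def)

lemma ext_pow_simps [simp]:
  "(ext F ^^ n) [] = []" "(ext F ^^ n) (u @ v) = (ext F ^^ n) u @ (ext F ^^ n) v"
  by (induction n) auto

lemma ext_pow: "(ext F ^^ n) w = ext (\<lambda>x. (ext F ^^ n) [x]) w"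
proof (induction w)
  case (Cons x w)
  have "(ext F ^^ n) (x # w) = (ext F ^^ n) [x] @ (ext F ^^ n) w"
    using ext_pow_simps(2)[of n F "[x]" w] by simp
  then show ?case using Cons by simp
qed simp

text \<open>A choice of words for the images of the letters and of their inverses that induces an
  endomorphism of the free group. Letters outside the alphabet have images too, so
  that \<open>ext F\<close> maps all words into \<open>words A\<close>.\<close>

locale group_endo =
  fixes A :: "'a set" and F :: "'a letter \<Rightarrow> 'a word"
  assumes F_in: "F x \<in> words A"
    and ext_red: "u \<in> words A \<Longrightarrow> v \<in> words A \<Longrightarrow> red u = red v \<Longrightarrow> red (ext F u) = red (ext F v)"
begin

lemma ext_in [simp]: "ext F w \<in> words A"
  by (induction w) (auto simp: F_in)

lemma ext_pow_in [simp]: "w \<in> words A \<Longrightarrow> (ext F ^^ n) w \<in> words A"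
  by (cases n) auto

lemma ext_pow_red:
  "u \<in> words A \<Longrightarrow> v \<in> words A \<Longrightarrow> red u = red v \<Longrightarrow> red ((ext F ^^ n) u) = red ((ext F ^^ n) v)"
  by (induction n) (auto intro: ext_red)

lemma ext_pow_fixed:
  assumes "w \<in> words A" "red (ext F w) = red w"
  shows "red ((ext F ^^ n) w) = red w"
proof (induction n)
  case (Suc n)
  have "red (ext F ((ext F ^^ n) w)) = red (ext F w)"
    using Suc assms by (intro ext_red) auto
  then show ?case using assms by simp
qed simp

lemma ext_pow_periodic:
  assumes "w \<in> words A" "red ((ext F ^^ m) w) = red w"
  shows "red ((ext F ^^ (m * k)) w) = red w"
proof (induction k)
  case (Suc k)
  have "red ((ext F ^^ m) ((ext F ^^ (m * k)) w)) = red ((ext F ^^ m) w)"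
    using Suc assms by (intro ext_pow_red) auto
  then show ?case using assms by (simp add: funpow_add)
qed simp

end

text \<open>The index is a multiple of the period that exceeds the preperiod.\<close>

lemma eventually_idempotent:
  fixes s :: "nat \<Rightarrow> 'b"
  assumes "finite (range s)" and det: "\<And>i j. s i = s j \<Longrightarrow> s (Suc i) = s (Suc j)"
  obtains n where "n \<ge> 1" "s (2 * n) = s n"
proof -
  have "\<not> inj s" using assms(1) finite_imageD infinite_UNIV_nat by blast
  then obtain i j where ij: "i < j" "s i = s j"
    by (metis injI linorder_neqE_nat)
  define d where "d = j - i"
  have shift: "s (i + t) = s (j + t)" for t
    by (induction t) (auto simp: ij intro: det)
  have per1: "s (m + d) = s m" if "m \<ge> i" for m
    using shift[of "m - i"] that ij by (simp add: d_def add.commute)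
  have per: "s (m + c * d) = s m" if "m \<ge> i" for m c
  proof (induction c)
    case (Suc c)
    then show ?case using per1[of "m + c * d"] that by (simp add: algebra_simps)
  qed simp
  have d: "d \<ge> 1" using ij by (simp add: d_def)
  define n where "n = (i + 1) * d"
  have n: "n \<ge> i + 1" using d unfolding n_def by (metis mult.right_neutral mult_le_mono2)
  have "s (n + n) = s n" using per[of n "i + 1"] n by (simp add: n_def)
  then show thesis using n by (intro that[of n]) (auto simp: mult_2)
qed


section \<open>Periods of endomorphisms of free groups\<close>

text \<open>Functions on the free monoid that are killed modulo \<open>p\<close> by \<open>n\<close> successive differences, that
  is, polynomial functions of degree less than \<open>n\<close> with values modulo \<open>p\<close>.\<close>

fun poly_fun :: "'a set \<Rightarrow> nat \<Rightarrow> nat \<Rightarrow> ('a word \<Rightarrow> int) \<Rightarrow> bool" where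
  "poly_fun A p 0 f \<longleftrightarrow> (\<forall>w\<in>words A. int p dvd f w)"
| "poly_fun A p (Suc n) f \<longleftrightarrow> (\<forall>h\<in>words A. poly_fun A p n (\<lambda>w. f (h @ w) - f w))"

lemma poly_fun_0: "(\<And>w. w \<in> words A \<Longrightarrow> int p dvd f w) \<Longrightarrow> poly_fun A p n f"
  by (induction n arbitrary: f) auto

lemma poly_fun_add: "poly_fun A p n f \<Longrightarrow> poly_fun A p n g \<Longrightarrow> poly_fun A p n (\<lambda>w. f w + g w)"
proof (induction n arbitrary: f g)
  case (Suc n)
  have "poly_fun A p n (\<lambda>w. (f (h @ w) - f w) + (g (h @ w) - g w))" if "h \<in> words A" for h
    using Suc.prems that by (intro Suc.IH) auto
  then show ?case by (simp add: algebra_simps)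
qed auto

lemma poly_fun_cmult: "poly_fun A p n f \<Longrightarrow> poly_fun A p n (\<lambda>w. c * f w)"
proof (induction n arbitrary: f)
  case (Suc n)
  have "poly_fun A p n (\<lambda>w. c * (f (h @ w) - f w))" if "h \<in> words A" for h
    using Suc.prems that by (intro Suc.IH) auto
  then show ?case by (simp add: algebra_simps)
qed auto

lemma poly_fun_diff: "poly_fun A p n f \<Longrightarrow> poly_fun A p n g \<Longrightarrow> poly_fun A p n (\<lambda>w. f w - g w)"
  using poly_fun_add[of A p n f "\<lambda>w. (-1) * g w"] poly_fun_cmult[of A p n g "-1"] by simp

lemma poly_fun_Suc: "poly_fun A p n f \<Longrightarrow> poly_fun A p (Suc n) f"
proof (induction n arbitrary: f)
  case (Suc n)
  show ?case
    unfolding poly_fun.simps(2)[of A p "Suc n" f] using Suc by auto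
qed auto

lemma poly_fun_mono:
  assumes "poly_fun A p n f" "n \<le> m"
  shows "poly_fun A p m f"
  using assms(2) by (induction rule: dec_induct) (use assms(1) poly_fun_Suc in blast)+

lemma (in group_endo) poly_fun_ext: "poly_fun A p n f \<Longrightarrow> poly_fun A p n (\<lambda>w. f (ext F w))"
proof (induction n arbitrary: f)
  case (Suc n)
  have "poly_fun A p n (\<lambda>w. f (ext F h @ ext F w) - f (ext F w))" for h
    using Suc.prems by (intro Suc.IH[of "\<lambda>w. f (ext F h @ w) - f w"]) simp
  then show ?case by simp
qed simp

lemma count_ext:
  assumes "finite A" "w \<in> words A"
  shows "count_list (ext F w) y = (\<Sum>x\<in>letters A. count_list w x * count_list (F x) y)"
  using assms(2)
proof (induction w)
  case (Cons x w)
  then have "(\<Sum>z\<in>letters A. count_list (x # w) z * count_list (F z) y)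
    = (\<Sum>z\<in>letters A. (if z = x then count_list (F x) y else 0) + count_list w z * count_list (F z) y)"
    by (intro sum.cong) auto
  then show ?case
    using Cons assms(1) by (simp add: sum.distrib finite_letters)
qed simp

text \<open>Modulo functions of lower degree, the difference \<open>f (h @ w) - f w\<close> is additive in \<open>h\<close>: in
  \<open>f (x @ h @ w) - f w\<close> the deviation from additivity is a second difference.\<close>

lemma poly_fun_difference_additive:
  assumes "finite A" "poly_fun A p (Suc (Suc n)) f" "h \<in> words A"
  shows "poly_fun A p n
    (\<lambda>w. f (h @ w) - f w - (\<Sum>x\<in>letters A. int (count_list h x) * (f (x # w) - f w)))"
  using assms(3)
proof (induction h)
  case Nil
  then show ?case by (simp add: poly_fun_0)
next
  case (Cons x h)
  let ?S = "\<lambda>h w. \<Sum>z\<in>letters A. int (count_list h z) * (f (z # w) - f w)"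
  have x: "x \<in> letters A" and h: "h \<in> words A" using Cons by auto
  have "[x] \<in> words A" using x by simp
  then have "poly_fun A p (Suc n) (\<lambda>w. f ([x] @ w) - f w)"
    using assms(2) unfolding poly_fun.simps(2)[of A p "Suc n" f] by blast
  then have "poly_fun A p n (\<lambda>w. (f (x # h @ w) - f (h @ w)) - (f (x # w) - f w))"
    using h unfolding poly_fun.simps(2)[of A p n] by auto
  then have "poly_fun A p n (\<lambda>w. ((f (x # h @ w) - f (h @ w)) - (f (x # w) - f w))
      + (f (h @ w) - f w - ?S h w))"
    by (rule poly_fun_add) (use Cons h in auto)
  moreover have "?S (x # h) w = (f (x # w) - f w) + ?S h w" for w
  proof -
    have "?S (x # h) w = (\<Sum>z\<in>letters A. (if z = x then f (x # w) - f w else 0)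
        + int (count_list h z) * (f (z # w) - f w))"
      by (intro sum.cong) (auto simp: algebra_simps)
    then show ?thesis using x assms(1) by (simp add: sum.distrib finite_letters)
  qed
  ultimately show ?case by (simp add: algebra_simps)
qed

context group_endo
begin

definition count_idem :: "nat \<Rightarrow> bool" where
  "count_idem p \<longleftrightarrow> (\<forall>h\<in>words A. \<forall>y\<in>letters A.
     int p dvd int (count_list (ext F (ext F h)) y) - int (count_list (ext F h) y))"

text \<open>The difference of \<open>f\<close> by \<open>h\<close> depends, up to lower degree, only on the letter counts of \<open>h\<close>
  modulo \<open>p\<close>. Hence idempotence on letter counts is inherited, up to lower degree, by the action
  on polynomial functions.\<close>

lemma poly_fun_degree_drop:
  assumes "finite A" "count_idem p" "poly_fun A p (Suc n) f"
  shows "poly_fun A p n (\<lambda>w. f (ext F (ext F w)) - f (ext F w))"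
  using assms(3)
proof (induction n arbitrary: f)
  case 0
  have *: "int p dvd f w - f []" if "w \<in> words A" for w
  proof -
    have "\<forall>v\<in>words A. int p dvd f (w @ v) - f v"
      using 0 that by (simp del: dvd_diff)
    from bspec[OF this Nil_in_words] show ?thesis by simp
  qed
  show ?case
    using dvd_diff[OF *[of "ext F (ext F w)" for w] *[of "ext F w" for w]] by auto
next
  case (Suc n)
  show ?case unfolding poly_fun.simps(2)[of A p n]
  proof
    fix h assume h: "h \<in> words A"
    define a b where "a = ext F (ext F h)" and "b = ext F h"
    have ab: "a \<in> words A" "b \<in> words A" by (simp_all add: a_def b_def)
    let ?S = "\<lambda>h w. \<Sum>z\<in>letters A. int (count_list h z) * (f (z # w) - f w)"
    have "poly_fun A p (Suc n) (\<lambda>w. f (a @ w) - f w)"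
      using Suc.prems ab unfolding poly_fun.simps(2)[of A p "Suc n" f] by blast
    from Suc.IH[OF this] have 1: "poly_fun A p n (\<lambda>w. (f (a @ ext F (ext F w)) - f (ext F (ext F w)))
        - (f (a @ ext F w) - f (ext F w)))" .
    have "poly_fun A p n (\<lambda>w. ?S a w - ?S b w)"
    proof (rule poly_fun_0)
      fix w
      have "?S a w - ?S b w
          = (\<Sum>z\<in>letters A. (int (count_list a z) - int (count_list b z)) * (f (z # w) - f w))"
        by (simp add: sum_subtractf left_diff_distrib)
      also have "int p dvd \<dots>"
        using assms(2) h by (intro dvd_sum dvd_mult2) (auto simp: count_idem_def a_def b_def)
      finally show "int p dvd ?S a w - ?S b w" .
    qed
    moreover have "poly_fun A p n (\<lambda>w. (f (a @ w) - f w - ?S a w) - (f (b @ w) - f w - ?S b w))"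
      by (intro poly_fun_diff poly_fun_difference_additive assms(1) Suc.prems ab)
    ultimately have "poly_fun A p n (\<lambda>w. ((f (a @ w) - f w - ?S a w) - (f (b @ w) - f w - ?S b w))
        + (?S a w - ?S b w))" by (rule poly_fun_add[rotated])
    then have "poly_fun A p n (\<lambda>w. f (a @ w) - f (b @ w))" by (simp add: algebra_simps)
    from poly_fun_add[OF 1 poly_fun_ext[OF this]]
    show "poly_fun A p n (\<lambda>w. f (ext F (ext F (h @ w))) - f (ext F (h @ w))
        - (f (ext F (ext F w)) - f (ext F w)))"
      by (simp add: algebra_simps a_def b_def)
  qed
qed

text \<open>Along a periodic orbit, the increments \<open>h\<close> of the values \<open>g\<close> of \<open>f\<close> are values of a function of
  lower degree. If they have period \<open>P\<close>, then \<open>g (i + P) - g i\<close> does not depend on \<open>i\<close>, and after \<open>p\<close>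
  such steps the total increment vanishes modulo \<open>p\<close>.\<close>

lemma poly_fun_orbit_period:
  assumes "finite A" "count_idem p" "x \<in> words A" "m \<ge> 1" "red ((ext F ^^ m) x) = red x"
    and "poly_fun A p n f"
    and "\<And>u v. u \<in> words A \<Longrightarrow> v \<in> words A \<Longrightarrow> red u = red v \<Longrightarrow> f u = f v"
  shows "int p dvd f ((ext F ^^ (i + p ^ n)) x) - f ((ext F ^^ i) x)"
  using assms(6,7)
proof (induction n arbitrary: f i)
  case 0
  have "(ext F ^^ j) x \<in> words A" for j using assms(3) by (rule ext_pow_in)
  then show ?case using 0(1) by (intro dvd_diff) (auto simp del: funpow.simps)
next
  case (Suc n)
  define f' where "f' = (\<lambda>w. f (ext F (ext F w)) - f (ext F w))"
  define g where "g i = f ((ext F ^^ i) x)" for i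
  define h where "h i = g (Suc i) - g i" for i
  define P where "P = p ^ n"
  have f': "f' u = f' v" if "u \<in> words A" "v \<in> words A" "red u = red v" for u v
    unfolding f'_def using that by (intro arg_cong2[of _ _ _ _ "(-)"] Suc.prems(2) ext_red ext_in)
  have IH: "int p dvd f' ((ext F ^^ (i + P)) x) - f' ((ext F ^^ i) x)" for i
    using poly_fun_degree_drop[OF assms(1,2) Suc.prems(1)] f'
    unfolding P_def f'_def[symmetric] by (rule Suc.IH)
  have f'_h: "f' ((ext F ^^ i) x) = h (Suc i)" for i
    by (simp add: f'_def h_def g_def)
  have g_per: "g (i + m) = g i" for i
    unfolding g_def funpow_add o_apply
    by (intro Suc.prems(2) ext_pow_red ext_pow_in assms)
  have h_per: "h (i + m) = h i" for i
    using g_per[of i] g_per[of "Suc i"] by (simp add: h_def)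
  have hP: "int p dvd h (i + P) - h i" for i
  proof -
    obtain m' where m: "m = Suc m'" using assms(4) by (cases m) auto
    have "h (i + P) - h i = h (Suc (i + m' + P)) - h (Suc (i + m'))"
      using h_per[of "i + P"] h_per[of i] by (simp add: m algebra_simps)
    then show ?thesis using IH[of "i + m'"] by (simp add: f'_h)
  qed
  have const: "int p dvd (g (i + s + P) - g (i + s)) - (g (i + P) - g i)" for i s
  proof (induction s)
    case (Suc s)
    have eq: "(g (i + Suc s + P) - g (i + Suc s)) - (g (i + P) - g i)
        = ((g (i + s + P) - g (i + s)) - (g (i + P) - g i)) + (h (i + s + P) - h (i + s))"
      by (simp add: h_def)
    show ?case unfolding eq by (rule dvd_add[OF Suc hP])
  qed simp
  have "int p dvd (g (i + s * P) - g i) - int s * (g (i + P) - g i)" for s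
  proof (induction s)
    case (Suc s)
    have eq: "(g (i + Suc s * P) - g i) - int (Suc s) * (g (i + P) - g i)
       = ((g (i + s * P) - g i) - int s * (g (i + P) - g i))
         + ((g (i + s * P + P) - g (i + s * P)) - (g (i + P) - g i))"
      by (simp add: algebra_simps)
    show ?case unfolding eq by (rule dvd_add[OF Suc const])
  qed simp
  from this[of p] have "int p dvd ((g (i + p * P) - g i) - int p * (g (i + P) - g i))
      + int p * (g (i + P) - g i)"
    by (rule dvd_add) simp
  then show ?case by (simp add: g_def P_def)
qed

end

text \<open>A representation of the free group by unitriangular matrices that detects \<open>u\<close>. Row vectors are
  indexed by the positions of \<open>u\<close>; a letter \<open>x\<close> adds every entry to its right neighbour across an
  occurrence of \<open>x\<close> in \<open>u\<close>, and undoes what the inverse letter does across an occurrence of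
  that. Only the entries up to the length of \<open>u\<close> matter.\<close>

fun sweep :: "'a word \<Rightarrow> 'a letter \<Rightarrow> (nat \<Rightarrow> int) \<Rightarrow> nat \<Rightarrow> int" where
  "sweep u x v 0 = v 0"
| "sweep u x v (Suc i) = v (Suc i) +
     (if u ! i = x then v i else if u ! i = letter_inv x then - sweep u x v i else 0)"

lemma sweep_inv [simp]: "sweep u (letter_inv x) (sweep u x v) = v"
proof
  show "sweep u (letter_inv x) (sweep u x v) i = v i" for i
    by (induction i) auto
qed

lemma sweep_inv' [simp]: "sweep u x (sweep u (letter_inv x) v) = v"
  using sweep_inv[of u "letter_inv x" v] by simp

lemma fold_sweep_push: "fold (sweep u) (push x r) v = fold (sweep u) r (sweep u x v)"
  by (cases r) auto

lemma fold_sweep_red: "fold (sweep u) (red w) v = fold (sweep u) w v"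
  by (induction w arbitrary: v) (auto simp: red_Cons fold_sweep_push)

lemma sweep_diff: "sweep u x (\<lambda>i. v i - v' i) i = sweep u x v i - sweep u x v' i"
  by (induction i) auto

lemma fold_sweep_diff:
  "fold (sweep u) w (\<lambda>i. v i - v' i) i = fold (sweep u) w v i - fold (sweep u) w v' i"
proof (induction w arbitrary: v v')
  case (Cons x w)
  have "sweep u x (\<lambda>i. v i - v' i) = (\<lambda>i. sweep u x v i - sweep u x v' i)"
    by (rule ext) (rule sweep_diff)
  then show ?case using Cons by simp
qed simp

lemma fold_sweep_low:
  assumes "\<forall>j<s. v j = 0" "i \<le> s"
  shows "fold (sweep u) w v i = v i"
  using assms
proof (induction w arbitrary: v i)
  case (Cons x w)
  have 0: "j < s \<Longrightarrow> sweep u x v j = 0" for j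
    using Cons.prems(1) by (induction j) auto
  have "sweep u x v i = v i" using Cons.prems 0 by (cases i) auto
  then show ?case using Cons.IH[of "sweep u x v" i] 0 Cons.prems by simp
qed simp

text \<open>Taking a difference moves the support of the vector one position to the right, and entries
  to the right of \<open>i\<close> do not influence the entry \<open>i\<close>.\<close>

lemma poly_fun_sweep:
  "(\<And>j. j + n \<le> i \<Longrightarrow> v j = 0) \<Longrightarrow> poly_fun A p n (\<lambda>w. fold (sweep u) w v i)"
proof (induction n arbitrary: v)
  case 0
  then have "fold (sweep u) w v i = v i" for w by (intro fold_sweep_low[of i]) auto
  then show ?case using 0 by simp
next
  case (Suc n)
  have "poly_fun A p n (\<lambda>w. fold (sweep u) (h @ w) v i - fold (sweep u) w v i)" for h
  proof -
    have "fold (sweep u) h v j = v j" if "j + n \<le> i" for j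
      using Suc.prems that by (intro fold_sweep_low[of "i - n"]) auto
    then have "poly_fun A p n (\<lambda>w. fold (sweep u) w (\<lambda>j. fold (sweep u) h v j - v j) i)"
      by (intro Suc.IH) auto
    then show ?thesis by (simp add: fold_sweep_diff)
  qed
  then show ?case by simp
qed

lemma reduced_nth: "reduced u \<Longrightarrow> Suc k < length u \<Longrightarrow> u ! Suc k \<noteq> letter_inv (u ! k)"
  by (simp add: reduced_def successively_conv_nth)

text \<open>After \<open>k\<close> letters the initial entry has reached position \<open>k\<close>. It cannot get further ahead
  by undoing an inverse letter, as \<open>u\<close> is reduced.\<close>

lemma fold_sweep_self:
  assumes "reduced u" "k \<le> length u"
  shows "fold (sweep u) (take k u) (\<lambda>i. if i = 0 then 1 else 0) k = 1 \<and>
    (\<forall>i. k < i \<and> i \<le> length u \<longrightarrow> fold (sweep u) (take k u) (\<lambda>i. if i = 0 then 1 else 0) i = 0)"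
  using assms(2)
proof (induction k)
  case (Suc k)
  define v where "v = fold (sweep u) (take k u) (\<lambda>i. if i = 0 then 1 else 0)"
  have v: "v k = 1" "\<And>i. k < i \<Longrightarrow> i \<le> length u \<Longrightarrow> v i = 0"
    using Suc by (auto simp: v_def)
  have step: "fold (sweep u) (take (Suc k) u) (\<lambda>i. if i = 0 then 1 else 0) = sweep u (u ! k) v"
    using Suc.prems by (simp add: take_Suc_conv_app_nth v_def)
  have "sweep u (u ! k) v i = 0" if "Suc k < i" "i \<le> length u" for i
    using that
  proof (induction i)
    case (Suc i)
    show ?case
    proof (cases "i = Suc k")
      case True
      then show ?thesis using v Suc.prems reduced_nth[OF assms(1), of k] by auto
    next
      case False
      then show ?thesis using v Suc by auto
    qed
  qed simp
  then show ?case using v Suc.prems by (simp add: step)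
qed simp

text \<open>With \<open>u\<close> the reduction of \<open>x\<inverse> y\<close>, the function takes a word \<open>w\<close> to the corner entry of the
  matrix of \<open>x\<inverse> w\<close>.\<close>

lemma poly_fun_separates:
  fixes x y :: "'a word"
  assumes "red x \<noteq> red y"
  shows "\<exists>f. f x = 0 \<and> f y = 1 \<and> (\<forall>u v. red u = red v \<longrightarrow> f u = f v) \<and>
    poly_fun A p (Suc (length (red (word_inv x @ y)))) f"
proof -
  define u where "u = red (word_inv x @ y)"
  define e :: "nat \<Rightarrow> int" where "e = (\<lambda>i. if i = 0 then 1 else 0)"
  define f where "f w = fold (sweep u) w (fold (sweep u) (word_inv x) e) (length u)" for w
  have f: "f w = fold (sweep u) (word_inv x @ w) e (length u)" for w
    by (simp add: f_def)
  have f_red: "f w = fold (sweep u) (red (word_inv x @ w)) e (length u)" for w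
    unfolding f fold_sweep_red ..
  have u: "reduced u" "u \<noteq> []"
    using assms red_eqI_inv[of x y] by (auto simp: u_def)
  show ?thesis
  proof (intro exI[of _ f] conjI allI impI)
    show "f x = 0" using u by (simp add: f_red e_def)
    show "f y = 1" using fold_sweep_self[OF u(1) order.refl] by (simp add: f_red e_def u_def)
    show "f a = f b" if "red a = red b" for a b
      using fold_sweep_red[of u a] fold_sweep_red[of u b] that by (simp add: f_def)
    show "poly_fun A p (Suc (length (red (word_inv x @ y)))) f"
      unfolding f_def u_def[symmetric] by (rule poly_fun_sweep) simp
  qed
qed

context group_endo
begin

text \<open>The degree of a function that separates \<open>x\<close> from another point of its orbit is bounded, so
  one exponent \<open>n\<close> serves for the entire orbit.\<close>

lemma periodic_prime_power:
  assumes "finite A" "count_idem p" "p \<ge> 2" "x \<in> words A" "m \<ge> 1" "red ((ext F ^^ m) x) = red x"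
    and B: "\<And>i. length (red (word_inv x @ (ext F ^^ i) x)) < n"
  shows "red ((ext F ^^ (p ^ n)) x) = red x"
proof (rule ccontr)
  assume "red ((ext F ^^ (p ^ n)) x) \<noteq> red x"
  then have ne: "red x \<noteq> red ((ext F ^^ (p ^ n)) x)" by simp
  from poly_fun_separates[OF ne, of A p] obtain f
    where f: "f x = 0" "f ((ext F ^^ (p ^ n)) x) = 1" "\<forall>u v. red u = red v \<longrightarrow> f u = f v"
    and deg: "poly_fun A p (Suc (length (red (word_inv x @ (ext F ^^ (p ^ n)) x)))) f"
    by blast
  have "poly_fun A p n f" by (rule poly_fun_mono[OF deg Suc_leI[OF B]])
  then have "int p dvd f ((ext F ^^ (0 + p ^ n)) x) - f ((ext F ^^ 0) x)"
    by (rule poly_fun_orbit_period[OF assms(1,2,4,5,6)]) (use f(3) in blast)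
  then show False using f(1,2) assms(3) by simp
qed

text \<open>The least period divides a power of 2 and a power of 3.\<close>

lemma periodic_imp_fixed:
  assumes "finite A" "count_idem 2" "count_idem 3" "x \<in> words A" "m \<ge> 1"
    and per: "red ((ext F ^^ m) x) = red x"
  shows "red (ext F x) = red x"
proof -
  define n where "n = Suc (Max ((\<lambda>i. length (red (word_inv x @ (ext F ^^ i) x))) ` {..<m}))"
  have "length (red (word_inv x @ (ext F ^^ i) x)) < n" for i
  proof -
    have "red ((ext F ^^ (i mod m + m * (i div m))) x) = red ((ext F ^^ (i mod m)) x)"
      unfolding funpow_add o_apply
      by (intro ext_pow_red ext_pow_periodic ext_pow_in per assms)
    then have "red (word_inv x @ (ext F ^^ i) x) = red (word_inv x @ (ext F ^^ (i mod m)) x)"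
      by (intro red_cong) simp_all
    then show ?thesis
      using assms(5) unfolding n_def by (auto simp: less_Suc_eq_le intro!: Max_ge imageI)
  qed
  then have 2: "red ((ext F ^^ (2 ^ n)) x) = red x" and 3: "red ((ext F ^^ (3 ^ n)) x) = red x"
    using periodic_prime_power[OF assms(1) _ _ assms(4,5) per] assms(2,3) by auto
  have "coprime (2 ^ n :: nat) (3 ^ n)" by simp
  then obtain a b :: nat where ab: "2 ^ n * a = 3 ^ n * b + 1"
    using bezout_nat[of "2 ^ n" "3 ^ n"] by auto
  have "red x = red ((ext F ^^ (1 + 3 ^ n * b)) x)"
    using ext_pow_periodic[OF assms(4) 2, of a] ab by (simp add: add.commute)
  also have "\<dots> = red ((ext F ^^ 1) x)"
    unfolding funpow_add o_apply
    by (intro ext_pow_red ext_pow_in ext_pow_periodic 3 assms)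
  finally show ?thesis by simp
qed

end


context group_endo
begin

abbreviation pow_letters :: "nat \<Rightarrow> 'a letter \<Rightarrow> 'a word" where
  "pow_letters n x \<equiv> (ext F ^^ n) [x]"

lemma ext_pow_letters: "ext (pow_letters n) = ext F ^^ n"
  by (rule HOL.ext) (simp add: ext_pow[symmetric])

lemma group_endo_pow:
  assumes "n \<ge> 1"
  shows "group_endo A (pow_letters n)"
proof
  obtain n' where "n = Suc n'" using assms by (cases n) auto
  then show "pow_letters n x \<in> words A" for x by simp
qed (simp only: ext_pow_letters, rule ext_pow_red)

text \<open>The letter counts of the images of the letters modulo 6 are a matrix over a finite ring, and
  the sequence of its powers is eventually periodic.\<close>

lemma exists_count_idem:
  assumes "finite A"
  obtains n where "n \<ge> 1" "group_endo.count_idem A (pow_letters n) 2"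
    "group_endo.count_idem A (pow_letters n) 3"
proof -
  define s where "s n = (\<lambda>x\<in>letters A. \<lambda>y\<in>letters A. count_list (pow_letters n x) y mod 6)" for n
  have s: "s i = s j \<longleftrightarrow> (\<forall>x\<in>letters A. \<forall>y\<in>letters A.
      count_list (pow_letters i x) y mod 6 = count_list (pow_letters j x) y mod 6)" for i j
    unfolding s_def by (force simp: fun_eq_iff restrict_def)
  have "range s \<subseteq> PiE (letters A) (\<lambda>_. PiE (letters A) (\<lambda>_. {..<6}))"
    by (auto simp: s_def)
  then have fin: "finite (range s)"
    by (rule finite_subset) (intro finite_PiE finite_letters assms finite_lessThan)
  have det: "s (Suc i) = s (Suc j)" if "s i = s j" for i j
    unfolding s
  proof (intro ballI)
    fix x y assume xy: "x \<in> letters A" "y \<in> letters A"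
    have *: "count_list (pow_letters (Suc i) x) y mod 6 =
        (\<Sum>z\<in>letters A. (count_list (pow_letters i x) z mod 6) * count_list (F z) y mod 6) mod 6" for i
      using count_ext[OF assms, of "pow_letters i x" F y] xy
      by (simp add: mod_sum_eq mod_mult_left_eq)
    show "count_list (pow_letters (Suc i) x) y mod 6 = count_list (pow_letters (Suc j) x) y mod 6"
      unfolding * using that[unfolded s] xy by (intro arg_cong[of _ _ "\<lambda>t. t mod 6"] sum.cong) auto
  qed
  obtain n where n: "n \<ge> 1" "s (2 * n) = s n"
    using eventually_idempotent[of s, OF fin det] by blast
  interpret pow: group_endo A "pow_letters n" by (rule group_endo_pow[OF n(1)])
  have idem: "int 6 dvd int (count_list ((ext F ^^ n) ((ext F ^^ n) h)) y)
      - int (count_list ((ext F ^^ n) h) y)" if h: "h \<in> words A" and y: "y \<in> letters A" for h y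
  proof -
    have "(ext F ^^ n) ((ext F ^^ n) h) = ext (pow_letters (2 * n)) h"
      by (subst ext_pow_letters) (simp only: mult_2 funpow_add o_apply)
    moreover have "(ext F ^^ n) h = ext (pow_letters n) h" by (simp add: ext_pow_letters)
    ultimately have "int (count_list ((ext F ^^ n) ((ext F ^^ n) h)) y)
        - int (count_list ((ext F ^^ n) h) y)
        = (\<Sum>x\<in>letters A. int (count_list h x)
            * (int (count_list (pow_letters (2 * n) x) y) - int (count_list (pow_letters n x) y)))"
      by (simp only: count_ext[OF assms h] of_nat_sum of_nat_mult right_diff_distrib sum_subtractf)
    also have "int 6 dvd \<dots>"
    proof (intro dvd_sum dvd_mult)
      fix x assume "x \<in> letters A"
      then have "count_list (pow_letters (2 * n) x) y mod 6 = count_list (pow_letters n x) y mod 6"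
        using n(2) y unfolding s by blast
      then show "int 6 dvd int (count_list (pow_letters (2 * n) x) y) - int (count_list (pow_letters n x) y)"
        by (metis mod_eq_dvd_iff of_nat_mod)
    qed
    finally show ?thesis .
  qed
  have "pow.count_idem p" if "int p dvd int 6" for p
    unfolding pow.count_idem_def ext_pow_letters using idem dvd_trans[OF that] by blast
  from this[of 2] this[of 3] n(1) show thesis by (intro that[of n]) simp_all
qed

text \<open>The power of the endomorphism that is idempotent on letter counts modulo 2 and modulo 3
  has no periodic points other than fixed points.\<close>

theorem common_period:
  assumes "finite A"
  obtains n where "n \<ge> 1"
    "\<And>w m. w \<in> words A \<Longrightarrow> m \<ge> 1 \<Longrightarrow> red ((ext F ^^ m) w) = red w \<Longrightarrow> red ((ext F ^^ n) w) = red w"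
proof -
  obtain n where n: "n \<ge> 1" "group_endo.count_idem A (pow_letters n) 2"
      "group_endo.count_idem A (pow_letters n) 3"
    using exists_count_idem[OF assms] .
  interpret pow: group_endo A "pow_letters n" by (rule group_endo_pow[OF n(1)])
  show thesis
  proof
    fix w m assume w: "w \<in> words A" "m \<ge> 1" "red ((ext F ^^ m) w) = red w"
    have "red ((ext (pow_letters n) ^^ m) w) = red w"
      using ext_pow_periodic[OF w(1,3), of n] by (simp add: ext_pow_letters funpow_mult mult.commute)
    from pow.periodic_imp_fixed[OF assms n(2,3) w(1,2) this]
    show "red ((ext F ^^ n) w) = red w" by (simp add: ext_pow_letters)
  qed (rule n(1))
qed

end


section \<open>Fixed points of endomorphisms of free inverse monoids\<close>

locale fim_endo = group_endo +
  assumes ext_munn: "u \<in> words A \<Longrightarrow> v \<in> words A \<Longrightarrow> munn u = munn v \<Longrightarrow> red u = red v \<Longrightarrow>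
    munn (ext F u) = munn (ext F v)"
begin

lemma fim_endo_pow:
  assumes "n \<ge> 1"
  shows "fim_endo A (pow_letters n)"
proof -
  interpret pow: group_endo A "pow_letters n" by (rule group_endo_pow[OF assms])
  have *: "munn ((ext F ^^ n) u) = munn ((ext F ^^ n) v)"
    if "u \<in> words A" "v \<in> words A" "munn u = munn v" "red u = red v" for u v n
  proof (induction n)
    case (Suc n)
    have "munn (ext F ((ext F ^^ n) u)) = munn (ext F ((ext F ^^ n) v))"
      using that Suc by (intro ext_munn ext_pow_in ext_pow_red)
    then show ?case by simp
  qed (simp add: that)
  show ?thesis by unfold_locales (simp only: ext_pow_letters, rule *)
qed

lemma red_ext_word_inv:
  assumes "y \<in> words A"
  shows "red (ext F (word_inv y)) = red (word_inv (ext F y))"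
proof -
  have "red (ext F (y @ word_inv y)) = red (ext F [])"
    by (rule ext_red) (use assms in simp_all)
  then show ?thesis using red_eqI_inv[of "word_inv (ext F y)" "ext F (word_inv y)"] by simp
qed

text \<open>The equations \<open>y y\<inverse> y = y\<close> and \<open>y\<inverse> y y\<inverse> = y\<inverse>\<close> determine the inverse and pass to the
  images.\<close>

lemma munn_ext_word_inv:
  assumes y: "y \<in> words A"
  shows "munn (ext F (word_inv y)) = munn (word_inv (ext F y))"
proof -
  let ?Y = "ext F y" and ?Y' = "ext F (word_inv y)"
  have "munn (ext F (y @ word_inv y @ y)) = munn ?Y"
    by (rule ext_munn) (use y in \<open>simp_all add: red_append red_def\<close>)
  then have 1: "act ?Y ` munn ?Y' \<subseteq> munn ?Y" by (auto simp: munn_append)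
  have "munn (ext F (word_inv y @ y @ word_inv y)) = munn ?Y'"
    using munn_idem_append[of "word_inv y" "word_inv y"]
    by (intro ext_munn) (use y in \<open>simp_all add: red_append red_def\<close>)
  then have "act ?Y' ` munn ?Y \<subseteq> munn ?Y'" by (auto simp: munn_append)
  then have 2: "act (word_inv ?Y) ` munn ?Y \<subseteq> munn ?Y'"
    unfolding act_munn_cong[OF red_ext_word_inv[OF y]] .
  have "munn ?Y' \<subseteq> act (word_inv ?Y) ` munn ?Y"
  proof
    fix s assume "s \<in> munn ?Y'"
    then have "act ?Y s \<in> munn ?Y" "s = act (word_inv ?Y) (act ?Y s)"
      using 1 reduced_munn[of s ?Y'] by auto
    then show "s \<in> act (word_inv ?Y) ` munn ?Y" by blast
  qed
  then show ?thesis using 2 by (auto simp: munn_word_inv)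
qed

lemma munn_ext_idem_append:
  assumes "y \<in> words A"
  shows "munn (ext F y @ ext F (word_inv y) @ z) = munn (ext F y) \<union> munn z"
proof -
  have "munn (ext F y @ ext F (word_inv y) @ z) = munn (ext F y @ word_inv (ext F y) @ z)"
    by (intro munn_append_cong red_ext_word_inv munn_ext_word_inv assms HOL.refl)
  then show ?thesis by simp
qed

definition fixed :: "'a word \<Rightarrow> bool" where
  "fixed w \<longleftrightarrow> munn (ext F w) = munn w \<and> red (ext F w) = red w"

lemma fixed_append: "fixed u \<Longrightarrow> fixed v \<Longrightarrow> fixed (u @ v)"
  unfolding fixed_def
  using munn_append_cong[of "ext F u" u "ext F v" v] red_cong[of "ext F u" u "ext F v" v]
  by simp

lemma fixed_concat: "(\<And>u. u \<in> set ws \<Longrightarrow> fixed u) \<Longrightarrow> fixed (concat ws)"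
  by (induction ws) (auto intro: fixed_append simp: fixed_def[of "[]"])

lemma fixed_pow:
  assumes "w \<in> words A" "fixed w"
  shows "munn ((ext F ^^ j) w) = munn w \<and> red ((ext F ^^ j) w) = red w"
proof (induction j)
  case (Suc j)
  then show ?case
    using assms ext_munn[of "(ext F ^^ j) w" w] ext_red[of "(ext F ^^ j) w" w]
    by (simp add: fixed_def)
qed simp

end

lemma red_idems [simp]: "red (idems l) = []"
  by (induction l) (simp_all add: red_def)

lemma munn_idems_append: "munn (idems l @ v) = (\<Union>u\<in>set l. munn u) \<union> munn v"
  by (induction l) (auto simp: Un_assoc)

context fim_endo
begin

lemma munn_ext_idems_append:
  "set l \<subseteq> words A \<Longrightarrow> munn (ext F (idems l) @ z) = (\<Union>u\<in>set l. munn (ext F u)) \<union> munn z"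
  by (induction l) (auto simp: munn_ext_idem_append Un_assoc)

lemma red_ext_idems: "set l \<subseteq> words A \<Longrightarrow> red (ext F (idems l)) = []"
  using ext_red[of "idems l" "[]"] by simp

text \<open>The image of \<open>x\<close> under each power of the endomorphism is a factor of the fixed word \<open>w\<close>. So a
  translate of its Munn tree lies in the Munn tree of \<open>w\<close>, and the translating element is a vertex
  of the latter.\<close>

lemma fixed_letter_finite_orbit:
  assumes "w \<in> words A" "fixed w" "x \<in> set w"
  shows "finite (range (\<lambda>j. (munn (pow_letters j x), red (pow_letters j x))))"
proof -
  obtain p q where w: "w = p @ [x] @ q" using assms(3) split_list[of x w] by auto
  define Z where "Z = (\<lambda>(a, s). act (word_inv a) s) ` (munn w \<times> munn w)"
  have sub: "munn (pow_letters j x) \<subseteq> Z" for j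
  proof
    fix r assume r: "r \<in> munn (pow_letters j x)"
    let ?p = "(ext F ^^ j) p"
    have "(ext F ^^ j) w = ?p @ pow_letters j x @ (ext F ^^ j) q"
      by (simp only: w ext_pow_simps)
    then have "munn w = munn (?p @ pow_letters j x @ (ext F ^^ j) q)"
      using fixed_pow[OF assms(1,2), of j] by simp
    then have "red ?p \<in> munn w" "act ?p r \<in> munn w"
      using red_in_munn[of ?p] r by (auto simp: munn_append)
    moreover have "r = act (word_inv (red ?p)) (act ?p r)"
      using reduced_munn[OF r] red_word_inv_cong[of "red ?p" ?p]
        act_cong[of "word_inv (red ?p)" "word_inv ?p" "act ?p r"] by simp
    ultimately show "r \<in> Z"
      unfolding Z_def by (intro image_eqI[of _ _ "(red ?p, act ?p r)"]) auto
  qed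
  have "range (\<lambda>j. (munn (pow_letters j x), red (pow_letters j x))) \<subseteq> Pow Z \<times> Z"
    using sub red_in_munn by blast
  moreover have "finite Z" by (simp add: Z_def)
  ultimately show ?thesis by (meson finite_Pow_iff finite_SigmaI finite_subset)
qed

text \<open>Each letter \<open>x\<close> of finite orbit yields one fixed point. Some power \<open>k\<close> of the endomorphism is
  idempotent on these letters, so that the images of \<open>x\<close> from the \<open>k\<close>-th on are periodic and, by
  hypothesis, agree in the free group. The fixed point is their meet, with the union of their Munn
  trees. A fixed point \<open>x\<^sub>1 \<dots> x\<^sub>n\<close> is the product of the fixed points of its letters, since its Munn
  tree is, for each \<open>j\<close>, the union of translates of the Munn trees of the images of its letters under
  the \<open>k + j\<close>-th power, and the translating elements do not depend on \<open>j\<close>.\<close>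

theorem fixed_points_finitely_generated:
  assumes "finite A"
    and aper: "\<And>w m. w \<in> words A \<Longrightarrow> m \<ge> 1 \<Longrightarrow> red ((ext F ^^ m) w) = red w \<Longrightarrow> red (ext F w) = red w"
  obtains W where "finite W" "W \<subseteq> words A" "\<And>ws. ws \<in> lists W \<Longrightarrow> fixed (concat ws)"
    "\<And>w. w \<in> words A \<Longrightarrow> fixed w \<Longrightarrow>
      \<exists>ws\<in>lists W. munn (concat ws) = munn w \<and> red (concat ws) = red w"
proof -
  define mr where "mr w = (munn w, red w)" for w :: "'a word"
  define D where "D = {x \<in> letters A. finite (range (\<lambda>j. mr (pow_letters j x)))}"
  define s where "s j = (\<lambda>x\<in>D. mr (pow_letters j x))" for j
  have D: "x \<in> D \<Longrightarrow> [x] \<in> words A" for x by (simp add: D_def)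
  have finD: "finite D" using assms(1) by (simp add: D_def finite_letters)
  have s: "s i = s j \<longleftrightarrow> (\<forall>x\<in>D. mr (pow_letters i x) = mr (pow_letters j x))" for i j
    unfolding s_def by (force simp: fun_eq_iff restrict_def)
  have "range s \<subseteq> PiE D (\<lambda>x. range (\<lambda>j. mr (pow_letters j x)))"
    by (auto simp: s_def)
  then have fin: "finite (range s)"
    by (rule finite_subset) (intro finite_PiE finD, simp add: D_def)
  have det: "s (Suc i) = s (Suc j)" if "s i = s j" for i j
    using that ext_munn[OF ext_pow_in ext_pow_in] ext_red[OF ext_pow_in ext_pow_in] D
    unfolding s mr_def by simp
  obtain k where k: "k \<ge> 1" "s (2 * k) = s k"
    using eventually_idempotent[of s, OF fin det] by blast
  have idem: "munn (pow_letters (k + k) x) = munn (pow_letters k x)"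
      "red (pow_letters (k + k) x) = red (pow_letters k x)" if "x \<in> D" for x
    using k(2) that unfolding s mr_def mult_2 by auto
  have redk: "red (pow_letters (k + j) x) = red (pow_letters k x)" if x: "x \<in> D" for x j
  proof -
    have "red ((ext F ^^ k) (pow_letters k x)) = red (pow_letters k x)"
      using idem(2)[OF x] by (simp add: funpow_add)
    then have "red (ext F (pow_letters k x)) = red (pow_letters k x)"
      using D[OF x] k(1) by (intro aper) auto
    then have "red ((ext F ^^ j) (pow_letters k x)) = red (pow_letters k x)"
      using D[OF x] by (intro ext_pow_fixed) auto
    then show ?thesis by (simp add: funpow_add add.commute[of k])
  qed
  define g where "g x = idems (map (\<lambda>j. pow_letters (k + j) x) [0..<k]) @ pow_letters k x" for x
  have imgs: "set (map (\<lambda>j. pow_letters (k + j) x) [0..<k]) \<subseteq> words A" if "x \<in> D" for x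
    using D[OF that] by (auto simp del: funpow.simps)
  have g_in: "g x \<in> words A" if "x \<in> D" for x
    unfolding g_def append_in_words using D[OF that] imgs[OF that] by (simp del: set_map)
  have munn_g: "munn (g x) = (\<Union>j<k. munn (pow_letters (k + j) x))" for x
  proof -
    have "munn (pow_letters (k + 0) x) \<subseteq> (\<Union>j<k. munn (pow_letters (k + j) x))"
      using k(1) by (intro UN_upper) simp
    then show ?thesis by (auto simp: g_def munn_idems_append)
  qed
  have red_g: "red (g x) = red (pow_letters k x)" for x
    using red_cong[of "idems (map (\<lambda>j. pow_letters (k + j) x) [0..<k])" "[]"]
    by (simp add: g_def)
  have fixed_g: "fixed (g x)" if x: "x \<in> D" for x
  proof -
    have "munn (ext F (g x)) = (\<Union>j<k. munn (pow_letters (k + Suc j) x)) \<union> munn (pow_letters (k + Suc 0) x)"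
      unfolding g_def ext_simps munn_ext_idems_append[OF imgs[OF x]]
      by (simp add: image_image atLeast0LessThan)
    also have "\<dots> = (\<Union>j\<in>Suc ` {..<k}. munn (pow_letters (k + j) x))"
      using k(1) by (force intro: bexI[of _ 0])
    \<comment> \<open>The endomorphism permutes the trees cyclically.\<close>
    also have "\<dots> = (\<Union>j<k. munn (pow_letters (k + j) x))"
    proof -
      obtain k' where k': "k = Suc k'" using k(1) by (cases k) auto
      have "(\<Union>j\<in>Suc ` {..<k}. munn (pow_letters (k + j) x))
          = (\<Union>j\<in>Suc ` {..<k'}. munn (pow_letters (k + j) x)) \<union> munn (pow_letters (k + k) x)"
        by (auto simp: k' lessThan_Suc)
      also have "\<dots> = munn (pow_letters (k + 0) x) \<union> (\<Union>j\<in>Suc ` {..<k'}. munn (pow_letters (k + j) x))"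
        using idem(1)[OF x] by auto
      also have "\<dots> = (\<Union>j<k. munn (pow_letters (k + j) x))"
        by (simp add: k' lessThan_Suc_eq_insert_0)
      finally show ?thesis .
    qed
    finally have "munn (ext F (g x)) = munn (g x)" by (simp only: munn_g)
    moreover have "red (ext F (g x)) = red (ext F (pow_letters k x))"
      unfolding g_def ext_simps using red_ext_idems[OF imgs[OF x]]
      by (simp add: red_append act_cong[of _ "[]"])
    then have "red (ext F (g x)) = red (g x)"
      using redk[OF x, of 1] by (simp add: red_g)
    ultimately show ?thesis by (simp add: fixed_def)
  qed
  have prod: "munn (concat (map g w)) = (\<Union>j<k. munn ((ext F ^^ (k + j)) w))
      \<and> red (concat (map g w)) = red ((ext F ^^ k) w)" if "set w \<subseteq> D" for w
    using that
  proof (induction w)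
    case Nil
    show ?case using k(1) by (auto simp: lessThan_empty_iff)
  next
    case (Cons x w)
    then have x: "x \<in> D" and IH: "munn (concat (map g w)) = (\<Union>j<k. munn ((ext F ^^ (k + j)) w))"
        "red (concat (map g w)) = red ((ext F ^^ k) w)"
      by auto
    have split: "(ext F ^^ j) (x # w) = pow_letters j x @ (ext F ^^ j) w" for j
      using ext_pow_simps(2)[of j F "[x]" w] by simp
    have g_act: "act (g x) r = act (pow_letters (k + j) x) r" if "reduced r" for r j
      using redk[OF x, of j] red_g[of x] that by (intro act_cong) auto
    have "act (g x) ` munn (concat (map g w))
        = (\<Union>j<k. act (pow_letters (k + j) x) ` munn ((ext F ^^ (k + j)) w))"
      unfolding IH image_UN using g_act reduced_munn by (intro SUP_cong image_cong) blast+
    then have "munn (concat (map g (x # w))) = (\<Union>j<k. munn ((ext F ^^ (k + j)) (x # w)))"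
      unfolding split by (auto simp: munn_append munn_g)
    moreover have "red (concat (map g (x # w))) = red ((ext F ^^ k) (x # w))"
      unfolding split using red_cong[OF red_g[of x] IH(2)] by simp
    ultimately show ?case ..
  qed
  show thesis
  proof
    show "finite (g ` D)" using finD by simp
    show "g ` D \<subseteq> words A" using g_in by blast
    show "fixed (concat ws)" if "ws \<in> lists (g ` D)" for ws
      using that fixed_g by (intro fixed_concat) auto
    show "\<exists>ws\<in>lists (g ` D). munn (concat ws) = munn w \<and> red (concat ws) = red w"
      if w: "w \<in> words A" "fixed w" for w
    proof
      have wD: "set w \<subseteq> D"
        using fixed_letter_finite_orbit[OF w] w(1) by (auto simp: D_def mr_def words_iff)
      then show "map g w \<in> lists (g ` D)" by (auto intro!: imageI)
      have "(\<Union>j<k. munn w) = munn w" using k(1) by (auto simp: lessThan_empty_iff)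
      then show "munn (concat (map g w)) = munn w \<and> red (concat (map g w)) = red w"
        using prod[OF wD] fixed_pow[OF w] by simp
    qed
  qed
qed

end


section \<open>Prefixes of fixed points of endomorphisms of free groups\<close>

lemma finite_orbitI:
  fixes f :: "'v \<Rightarrow> 'v"
  assumes "(f ^^ i) w = (f ^^ j) w" "i < j"
  shows "finite (range (\<lambda>c. (f ^^ c) w))"
proof -
  have "(f ^^ c) w \<in> (\<lambda>t. (f ^^ t) w) ` {..<j}" for c
  proof (induction c rule: less_induct)
    case (less c)
    show ?case
    proof (cases "c < j")
      case False
      then have "(f ^^ c) w = (f ^^ (c - j)) ((f ^^ j) w)"
        by (simp flip: funpow_add[THEN fun_cong, unfolded o_apply])
      also have "\<dots> = (f ^^ (c - j + i)) w"
        by (simp add: assms(1) funpow_add)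
      finally show ?thesis using less[of "c - j + i"] False assms(2) by simp
    qed simp
  qed
  then have "range (\<lambda>c. (f ^^ c) w) \<subseteq> (\<lambda>t. (f ^^ t) w) ` {..<j}" by blast
  then show ?thesis by (rule finite_subset) simp
qed

definition branches :: "('v \<Rightarrow> 'v) \<Rightarrow> 'v \<Rightarrow> 'v \<Rightarrow> nat \<Rightarrow> nat \<Rightarrow> bool" where
  "branches f u w a b \<longleftrightarrow> (f ^^ a) u = (f ^^ b) w \<and>
     (a = 0 \<or> b = 0 \<or> (f ^^ (a - 1)) u \<noteq> (f ^^ (b - 1)) w)"

text \<open>If the orbit of \<open>u\<close> is infinite and meets the orbit of \<open>w\<close>, then both orbits are injective,
  and the first meeting point is the only one at which they come together from different points.\<close>

lemma finite_until_branch: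
  "finite {(f ^^ c) u | c. \<exists>a b. c \<le> a \<and> branches f u w a b}" (is "finite ?S")
proof (cases "finite (range (\<lambda>c. (f ^^ c) u))")
  case True
  then show ?thesis by (rule rev_finite_subset) auto
next
  case False
  have not_less: "\<not> a < a'" if 1: "branches f u w a b" and 2: "branches f u w a' b'" for a b a' b'
  proof
    assume less: "a < a'"
    have shift: "(f ^^ (t + a)) u = (f ^^ (t + b)) w" for t
      using 1 by (simp add: branches_def funpow_add)
    have "b' = a' - a + b"
    proof (rule ccontr)
      assume "b' \<noteq> a' - a + b"
      moreover have "(f ^^ b') w = (f ^^ (a' - a + b)) w"
        using shift[of "a' - a"] 2 less by (simp add: branches_def)
      ultimately have w: "finite (range (\<lambda>c. (f ^^ c) w))"
        using finite_orbitI[of b' f w] finite_orbitI[of "a' - a + b" f w] by (metis linorder_neqE_nat)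
      have "(f ^^ c) u \<in> range (\<lambda>c. (f ^^ c) w) \<union> (\<lambda>c. (f ^^ c) u) ` {..<a}" for c
        using shift[of "c - a"] by (cases "c < a") auto
      then have "range (\<lambda>c. (f ^^ c) u) \<subseteq> range (\<lambda>c. (f ^^ c) w) \<union> (\<lambda>c. (f ^^ c) u) ` {..<a}"
        by blast
      then have "finite (range (\<lambda>c. (f ^^ c) u))" by (rule finite_subset) (simp add: w)
      then show False using False by blast
    qed
    then have "(f ^^ (a' - 1)) u = (f ^^ (b' - 1)) w" "b' \<noteq> 0" "a' \<noteq> 0"
      using shift[of "a' - 1 - a"] less by auto
    then show False using 2 by (simp add: branches_def)
  qed
  show ?thesis
  proof (cases "\<exists>a b. branches f u w a b")
    case True
    then obtain a b where ab: "branches f u w a b" by blast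
    have "?S \<subseteq> (\<lambda>c. (f ^^ c) u) ` {..a}"
      using not_less[OF ab] not_less[OF _ ab] by (fastforce simp: not_less)
    then show ?thesis by (rule finite_subset) simp
  qed simp
qed

text \<open>A walk without backtracking in the graph of a function \<open>f\<close> goes up along \<open>f\<close> and then down
  against \<open>f\<close>. Hence a walk that starts and ends in a finite set \<open>B\<close>, uses the edges of \<open>f\<close> outside
  \<open>B\<close> and does not backtrack there, stays in a finite set that depends on \<open>B\<close> and \<open>f\<close> only.\<close>

lemma finite_zigzags:
  fixes f :: "'v \<Rightarrow> 'v"
  assumes "finite B"
  obtains C where "finite C"
    "\<And>v l up down i. \<lbrakk>v 0 \<in> B; v l \<in> B;
      \<And>j. j < l \<Longrightarrow> up j \<or> down j \<or> v j \<in> B \<and> v (Suc j) \<in> B;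
      \<And>j. j < l \<Longrightarrow> up j \<Longrightarrow> v (Suc j) = f (v j);
      \<And>j. j < l \<Longrightarrow> down j \<Longrightarrow> v j = f (v (Suc j));
      \<And>j. Suc j < l \<Longrightarrow> down j \<Longrightarrow> \<not> up (Suc j);
      \<And>j. Suc j < l \<Longrightarrow> up j \<Longrightarrow> down (Suc j) \<Longrightarrow> v j \<noteq> v (Suc (Suc j)); i \<le> l\<rbrakk> \<Longrightarrow> v i \<in> C"
proof
  define S where "S u w = {(f ^^ c) u | c. \<exists>a b. c \<le> a \<and> branches f u w a b}" for u w
  define C where "C = B \<union> (\<Union>u\<in>B. \<Union>w\<in>B. S u w)"
  show "finite C"
    using assms unfolding C_def S_def by (intro finite_UnI finite_UN_I finite_until_branch)
  fix v :: "nat \<Rightarrow> 'v" and l i :: nat and up down :: "nat \<Rightarrow> bool"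
  assume ends: "v 0 \<in> B" "v l \<in> B"
    and steps: "\<And>j. j < l \<Longrightarrow> up j \<or> down j \<or> v j \<in> B \<and> v (Suc j) \<in> B"
    and up: "\<And>j. j < l \<Longrightarrow> up j \<Longrightarrow> v (Suc j) = f (v j)"
    and down: "\<And>j. j < l \<Longrightarrow> down j \<Longrightarrow> v j = f (v (Suc j))"
    and down_up: "\<And>j. Suc j < l \<Longrightarrow> down j \<Longrightarrow> \<not> up (Suc j)"
    and up_down: "\<And>j. Suc j < l \<Longrightarrow> up j \<Longrightarrow> down (Suc j) \<Longrightarrow> v j \<noteq> v (Suc (Suc j))"
    and i: "i \<le> l"
  show "v i \<in> C"
  proof (cases "v i \<in> B")
    case True
    then show ?thesis by (simp add: C_def)
  next
    case iB: False
    \<comment> \<open>Consider the maximal segment around \<open>i\<close> whose interior avoids \<open>B\<close>.\<close>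
    define s where "s = Max {j. j \<le> i \<and> v j \<in> B}"
    define e where "e = Min {j. i \<le> j \<and> j \<le> l \<and> v j \<in> B}"
    have "s \<in> {j. j \<le> i \<and> v j \<in> B}" unfolding s_def
      using ends by (intro Max_in) auto
    then have s: "s \<le> i" "v s \<in> B" by auto
    have s_max: "j \<le> s" if "j \<le> i" "v j \<in> B" for j
      unfolding s_def using that by (intro Max_ge) auto
    have "e \<in> {j. i \<le> j \<and> j \<le> l \<and> v j \<in> B}" unfolding e_def
      using ends i by (intro Min_in) auto
    then have e: "i \<le> e" "e \<le> l" "v e \<in> B" by auto
    have e_min: "e \<le> j" if "i \<le> j" "j \<le> l" "v j \<in> B" for j
      unfolding e_def using that by (intro Min_le) auto
    have sie: "s < i" "i < e" using s e iB by (metis order_le_less)+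
    have ud: "up j \<or> down j" if "s \<le> j" "j < e" for j
    proof (rule ccontr)
      assume "\<not> (up j \<or> down j)"
      then have jB: "v j \<in> B" "v (Suc j) \<in> B" using steps[of j] that e by auto
      then have "\<not> (s < j \<and> j \<le> i)" "\<not> (i \<le> j \<and> j < e)" "\<not> (s < Suc j \<and> Suc j \<le> i)"
        using s_max[of j] e_min[of j] s_max[of "Suc j"] that e by auto
      then show False using that sie by linarith
    qed
    define t where "t = (if \<exists>j. s \<le> j \<and> j < e \<and> \<not> up j then LEAST j. s \<le> j \<and> j < e \<and> \<not> up j else e)"
    have "s \<le> t \<and> t \<le> e \<and> (t < e \<longrightarrow> \<not> up t)"
    proof (cases "\<exists>j. s \<le> j \<and> j < e \<and> \<not> up j")
      case True
      from LeastI_ex[OF this] True show ?thesis unfolding t_def by simp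
    next
      case False
      then have "t = e" unfolding t_def by (rule if_not_P)
      then show ?thesis using s e by simp
    qed
    then have t: "s \<le> t" "t \<le> e" "t < e \<Longrightarrow> \<not> up t" by auto
    have below: "up j" if "s \<le> j" "j < t" for j
      using not_less_Least[of j "\<lambda>j. s \<le> j \<and> j < e \<and> \<not> up j"] that t(2)
      by (auto simp: t_def split: if_splits)
    have above: "down (t + c)" if "t + c < e" for c
      using that
    proof (induction c)
      case 0
      then show ?case using ud[of t] t by auto
    next
      case (Suc c)
      then show ?case using ud[of "t + Suc c"] down_up[of "t + c"] t e by auto
    qed
    have rise: "v (s + c) = (f ^^ c) (v s)" if "s + c \<le> t" for c
      using that
    proof (induction c)
      case (Suc c)
      then show ?case using up[of "s + c"] below[of "s + c"] t e by simp
    qed simp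
    have fall: "v (e - c) = (f ^^ c) (v e)" if "c \<le> e - t" for c
      using that
    proof (induction c)
      case (Suc c)
      have "Suc (e - Suc c) = e - c" "t + (e - Suc c - t) = e - Suc c" using Suc.prems by auto
      then show ?case using Suc down[of "e - Suc c"] above[of "e - Suc c - t"] t e by simp
    qed simp
    define a b where "a = t - s" and "b = e - t"
    have meet: "(f ^^ a) (v s) = v t" "(f ^^ b) (v e) = v t"
      using rise[of a] fall[of b] t by (simp_all add: a_def b_def)
    have apex: "(f ^^ (a - 1)) (v s) \<noteq> (f ^^ (b - 1)) (v e)" if "a \<noteq> 0" "b \<noteq> 0"
    proof -
      have "s + (a - 1) = t - 1" "e - (b - 1) = Suc t" "Suc (t - 1) = t"
        using that t by (auto simp: a_def b_def)
      then have "(f ^^ (a - 1)) (v s) = v (t - 1)" "(f ^^ (b - 1)) (v e) = v (Suc (Suc (t - 1)))"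
        using rise[of "a - 1"] fall[of "b - 1"] that t by (auto simp: a_def b_def)
      moreover have "up (t - 1)" "down (Suc (t - 1))" "Suc (t - 1) < l"
        using below[of "t - 1"] above[of 0] that t e by (auto simp: a_def b_def)
      ultimately show ?thesis using up_down[of "t - 1"] by simp
    qed
    have br: "branches f (v s) (v e) a b" "branches f (v e) (v s) b a"
      using meet apex unfolding branches_def by metis+
    show ?thesis
    proof (cases "i \<le> t")
      case True
      then have "v i = (f ^^ (i - s)) (v s)" "i - s \<le> a" using rise[of "i - s"] sie by (auto simp: a_def)
      then have "v i \<in> S (v s) (v e)" unfolding S_def using br(1) by blast
      then show ?thesis unfolding C_def using s e by blast
    next
      case False
      then have "v i = (f ^^ (e - i)) (v e)" "e - i \<le> b" using fall[of "e - i"] sie by (auto simp: b_def)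
      then have "v i \<in> S (v e) (v s)" unfolding S_def using br(2) by blast
      then show ?thesis unfolding C_def using s e by blast
    qed
  qed
qed

text \<open>Each letter of \<open>s\<close> cancels at most one letter of \<open>r\<close>.\<close>

lemma hd_red_append:
  "reduced r \<Longrightarrow> length s < length r \<Longrightarrow> \<exists>t. red (r @ s) = hd r # t"
proof (induction s arbitrary: r)
  case Nil
  then show ?case by (cases r) auto
next
  case (Cons y s)
  show ?case
  proof (cases rule: red_snoc_cases[of r y])
    case extend
    then have "reduced (r @ [y])" using Cons.prems(1) by (metis reduced_red red_reduced)
    moreover have "r \<noteq> []" using Cons.prems by auto
    ultimately show ?thesis using Cons.IH[of "r @ [y]"] Cons.prems by simp
  next
    case (cancel t)
    have r: "r = t @ [letter_inv y]" using cancel Cons.prems(1) by simp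
    have "red (r @ y # s) = red (red (r @ [y]) @ s)" by (simp del: red_append)
    then have "red (r @ y # s) = red (t @ s)" by (simp add: cancel(2))
    moreover have "reduced t" using Cons.prems(1) reduced_appendD unfolding r by blast
    moreover have "t \<noteq> []" "length s < length t" using Cons.prems(2) by (auto simp: r)
    ultimately show ?thesis using Cons.IH[of t] r by simp
  qed
qed

context group_endo
begin

definition defect_step :: "'a letter \<Rightarrow> 'a word \<Rightarrow> 'a word" where
  "defect_step x v = red (letter_inv x # v @ F x)"

definition defect :: "'a word \<Rightarrow> 'a word" where
  "defect p = red (word_inv p @ ext F p)"

lemma defect_snoc: "defect (p @ [x]) = defect_step x (defect p)"
  unfolding defect_def defect_step_def
  using red_cong[of "letter_inv x # word_inv p @ ext F p" "letter_inv x # red (word_inv p @ ext F p)" "F x" "F x"]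
  by (simp add: red_Cons)

lemma red_F_inv: "x \<in> letters A \<Longrightarrow> red (F x @ F (letter_inv x)) = []"
  using ext_red[of "[x, letter_inv x]" "[]"] by (simp add: red_Cons)

text \<open>The vertices \<open>v\<close> of a graph are the reduced words; a letter \<open>x\<close> leads from \<open>v\<close> to
  \<open>defect_step x v\<close>. Words fixed by the endomorphism of the group label the closed walks at the
  empty word. Each nonempty \<open>v\<close> has a preferred edge, labelled by its first letter, and the
  following function maps \<open>v\<close> to the end of this edge.\<close>

fun preferred :: "'a word \<Rightarrow> 'a word" where
  "preferred [] = []"
| "preferred (x # v) = red (v @ F x)"

lemma defect_step_up: "defect_step x (x # v) = preferred (x # v)"
  by (simp add: defect_step_def)

lemma defect_step_down:
  assumes "reduced u" "x \<in> letters A" "defect_step x u = letter_inv x # v"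
  shows "u = preferred (letter_inv x # v)"
proof -
  have "red (v @ F (letter_inv x)) = red (x # (letter_inv x # v) @ F (letter_inv x))"
    by (simp add: red_Cons)
  also have "\<dots> = red ([x] @ red (letter_inv x # u @ F x) @ F (letter_inv x))"
    using assms(3) by (simp add: defect_step_def)
  also have "\<dots> = red ([x] @ (letter_inv x # u @ F x) @ F (letter_inv x))"
    by (intro red_cong) simp_all
  also have "\<dots> = red (u @ (F x @ F (letter_inv x)))"
    by (simp add: red_Cons)
  also have "\<dots> = red (u @ [])" by (intro red_cong) (simp_all add: red_F_inv assms)
  finally show ?thesis using assms(1) by simp
qed

text \<open>An edge that is preferred at neither end starts at a word that \<open>F x\<close> cancels entirely.\<close>

lemma defect_step_exceptional:
  assumes "reduced u" "\<nexists>v. u = x # v" "\<nexists>v. defect_step x u = letter_inv x # v"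
  shows "length u < length (F x)"
proof (rule ccontr)
  assume "\<not> length u < length (F x)"
  moreover have "reduced (letter_inv x # u)"
    using assms(1,2) by (cases u) (auto simp: reduced_Cons2)
  ultimately have "\<exists>v. red ((letter_inv x # u) @ F x) = hd (letter_inv x # u) # v"
    by (intro hd_red_append) auto
  then show False using assms(3) by (simp add: defect_step_def)
qed

text \<open>The argument of Goldstein and Turner for the finite generation of the fixed subgroup: all but
  finitely many edges are preferred at one of their ends, and a reduced closed walk does not
  backtrack.\<close>

theorem finite_defects:
  assumes "finite A"
  obtains C where "finite C"
    "\<And>w p q. w \<in> words A \<Longrightarrow> reduced w \<Longrightarrow> red (ext F w) = w \<Longrightarrow> w = p @ q \<Longrightarrow> defect p \<in> C"
proof -
  define M where "M = Max (insert 0 ((\<lambda>x. length (F x)) ` letters A))"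
  have M: "x \<in> letters A \<Longrightarrow> length (F x) \<le> M" for x
    unfolding M_def using assms by (intro Max_ge) (auto simp: finite_letters)
  define B where "B = {v. set v \<subseteq> letters A \<and> length v \<le> Suc (M + M)}"
  have "finite B" unfolding B_def
    using assms by (intro finite_lists_length_le finite_letters)
  then obtain C where C: "finite C" and zigzag:
    "\<And>v l up down i. \<lbrakk>v 0 \<in> B; v l \<in> B;
      \<And>j. j < l \<Longrightarrow> up j \<or> down j \<or> v j \<in> B \<and> v (Suc j) \<in> B;
      \<And>j. j < l \<Longrightarrow> up j \<Longrightarrow> v (Suc j) = preferred (v j);
      \<And>j. j < l \<Longrightarrow> down j \<Longrightarrow> v j = preferred (v (Suc j));
      \<And>j. Suc j < l \<Longrightarrow> down j \<Longrightarrow> \<not> up (Suc j);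
      \<And>j. Suc j < l \<Longrightarrow> up j \<Longrightarrow> down (Suc j) \<Longrightarrow> v j \<noteq> v (Suc (Suc j)); i \<le> l\<rbrakk> \<Longrightarrow> v i \<in> C"
    by (rule finite_zigzags[of B preferred]) blast
  have "defect (take i w) \<in> C"
    if w: "w \<in> words A" "reduced w" "red (ext F w) = w" and i: "i \<le> length w" for w i
  proof -
    define v where "v j = defect (take j w)" for j
    define up where "up j \<longleftrightarrow> (\<exists>t. v j = w ! j # t)" for j
    define down where "down j \<longleftrightarrow> (\<exists>t. v (Suc j) = letter_inv (w ! j) # t)" for j
    have v_red: "reduced (v j)" for j by (simp add: v_def defect_def)
    have wA: "w ! j \<in> letters A" if "j < length w" for j
      using that w(1) nth_mem by (auto simp: words_iff)
    have v_in: "v j \<in> words A" for j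
    proof -
      have "take j w \<in> words A" using w(1) set_take_subset[of j w] by (auto simp: words_iff)
      then show ?thesis by (simp add: v_def defect_def)
    qed
    have v_Suc: "v (Suc j) = defect_step (w ! j) (v j)" if "j < length w" for j
      using that by (simp add: v_def take_Suc_conv_app_nth defect_snoc)
    have "v i \<in> C"
    proof (rule zigzag[of v "length w" up down])
      show "v 0 \<in> B" by (simp add: v_def defect_def B_def)
      have "defect w = red (word_inv w @ red (ext F w))" unfolding defect_def by simp
      then have "defect w = []" by (simp add: w(3))
      then show "v (length w) \<in> B" by (simp add: v_def B_def)
      show "up j \<or> down j \<or> v j \<in> B \<and> v (Suc j) \<in> B" if j: "j < length w" for j
      proof (rule ccontr)
        assume *: "\<not> ?thesis"
        then have "length (v j) < length (F (w ! j))"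
          using v_red v_Suc[OF j] by (intro defect_step_exceptional) (auto simp: up_def down_def)
        then have "length (v j) < M" using M[OF wA[OF j]] by simp
        moreover have "length (v (Suc j)) \<le> Suc (length (v j) + length (F (w ! j)))"
          using length_red[of "letter_inv (w ! j) # v j @ F (w ! j)"]
          by (simp add: v_Suc[OF j] defect_step_def)
        ultimately show False
          using * M[OF wA[OF j]] v_in by (auto simp: B_def words_iff)
      qed
      show "v (Suc j) = preferred (v j)" if "j < length w" "up j" for j
        using that by (auto simp: up_def v_Suc defect_step_up)
      show "v j = preferred (v (Suc j))" if "j < length w" "down j" for j
        using that defect_step_down[OF v_red wA] v_Suc by (fastforce simp: down_def)
      show "\<not> up (Suc j)" if "Suc j < length w" "down j" for j
        using that reduced_nth[OF w(2), of j] by (auto simp: down_def up_def)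
      show "v j \<noteq> v (Suc (Suc j))" if "Suc j < length w" "up j" "down (Suc j)" for j
        using that reduced_nth[OF w(2), of j]
        by (auto simp: down_def up_def) (metis letter_inv_letter_inv)
    qed (rule i)
    then show ?thesis by (simp add: v_def)
  qed
  then have "defect p \<in> C"
    if "w \<in> words A" "reduced w" "red (ext F w) = w" "w = p @ q" for w p q
    using that by (metis append_eq_conv_conj le_add1 length_append)
  with C show thesis by (rule that)
qed

end


section \<open>Context-free grammars\<close>

text \<open>Derivation trees: each symbol of a sentential form yields a factor of its own.\<close>

inductive yields :: "('n, 't) prods \<Rightarrow> ('n, 't) sym list \<Rightarrow> 't list \<Rightarrow> bool"
  for P :: "('n, 't) prods" where
  Nil: "yields P [] []"
| Tm: "yields P s w \<Longrightarrow> yields P (Tm t # s) (t # w)"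
| Nt: "(B, r) \<in> P \<Longrightarrow> yields P r u \<Longrightarrow> yields P s v \<Longrightarrow> yields P (Nt B # s) (u @ v)"

inductive_cases yields_TmE: "yields P (Tm t # s) w"
inductive_cases yields_NtE: "yields P (Nt B # s) w"

lemma yields_append: "yields P s u \<Longrightarrow> yields P s' v \<Longrightarrow> yields P (s @ s') (u @ v)"
proof (induction rule: yields.induct)
  case (Nt B r u s w)
  then show ?case using yields.Nt[of B r P u "s @ s'" "w @ v"] by simp
qed (auto intro: yields.intros)

lemma yields_appendE:
  assumes "yields P (s @ s') w"
  obtains u v where "w = u @ v" "yields P s u" "yields P s' v"
  using assms
proof (induction s arbitrary: w thesis)
  case Nil
  then show ?case using yields.Nil by force
next
  case (Cons x s)
  show ?case
  proof (cases x)
    case (Nt B)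
    with Cons.prems(2) obtain r u v where 1: "(B, r) \<in> P" "yields P r u" "yields P (s @ s') v" "w = u @ v"
      by (auto elim: yields_NtE)
    obtain v1 v2 where "v = v1 @ v2" "yields P s v1" "yields P s' v2" using Cons.IH[OF _ 1(3)] .
    then show ?thesis using Cons.prems(1)[of "u @ v1" v2] 1 Nt by (auto intro: yields.intros)
  next
    case (Tm t)
    with Cons.prems(2) obtain v where 1: "w = t # v" "yields P (s @ s') v"
      by (auto elim: yields_TmE)
    obtain v1 v2 where "v = v1 @ v2" "yields P s v1" "yields P s' v2" using Cons.IH[OF _ 1(2)] .
    then show ?thesis using Cons.prems(1)[of "t # v1" v2] 1 Tm by (auto intro: yields.intros)
  qed
qed

lemma yields_Tms: "yields P (map Tm w) w"
  by (induction w) (auto intro: yields.intros)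

lemma derives1_context: "derives1 P s s' \<Longrightarrow> derives1 P (a @ s @ b) (a @ s' @ b)"
proof (induction rule: derives1.induct)
  case (1 B w u v)
  then show ?case using derives1.intros[of B w P "a @ u" "v @ b"] by simp
qed

lemma derives_context: "(derives1 P)\<^sup>*\<^sup>* s s' \<Longrightarrow> (derives1 P)\<^sup>*\<^sup>* (a @ s @ b) (a @ s' @ b)"
  by (induction rule: rtranclp_induct) (auto intro: rtranclp.rtrancl_into_rtrancl derives1_context)

lemma yields_imp_derives: "yields P s w \<Longrightarrow> (derives1 P)\<^sup>*\<^sup>* s (map Tm w)"
proof (induction rule: yields.induct)
  case (Tm s w t)
  then show ?case using derives_context[of P s "map Tm w" "[Tm t]" "[]"] by simp
next
  case (Nt B r u s v)
  have "derives1 P ([] @ [Nt B] @ s) ([] @ r @ s)" by (rule derives1.intros) (rule Nt)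
  moreover have "(derives1 P)\<^sup>*\<^sup>* ([] @ r @ s) ([] @ map Tm u @ s)"
    by (rule derives_context) (rule Nt)
  moreover have "(derives1 P)\<^sup>*\<^sup>* (map Tm u @ s @ []) (map Tm u @ map Tm v @ [])"
    by (rule derives_context) (rule Nt)
  ultimately show ?case by (auto intro: converse_rtranclp_into_rtranclp rtranclp_trans)
qed simp

lemma derives1_yields: "derives1 P s s' \<Longrightarrow> yields P s' w \<Longrightarrow> yields P s w"
proof (induction arbitrary: w rule: derives1.induct)
  case (1 B r u v)
  obtain a b c where "w = a @ b @ c" "yields P u a" "yields P r b" "yields P v c"
    using 1(2) by (metis yields_appendE)
  then show ?case using 1(1) by (auto intro!: yields_append yields.Nt)
qed

lemma derives_imp_yields: "(derives1 P)\<^sup>*\<^sup>* s (map Tm w) \<Longrightarrow> yields P s w"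
  by (induction rule: converse_rtranclp_induct) (auto intro: yields_Tms derives1_yields)

lemma Lang_eq_yields: "Lang P S = {w. yields P [Nt S] w}"
  using yields_imp_derives derives_imp_yields by (fastforce simp: Lang_def)

definition nts :: "('n, 't) sym list \<Rightarrow> 'n set" where
  "nts s = {B. Nt B \<in> set s}"

lemma finite_nts: "finite (nts s)"
proof -
  have "nts s \<subseteq> (\<lambda>x. case x of Nt B \<Rightarrow> B | Tm t \<Rightarrow> undefined) ` set s"
    by (force simp: nts_def)
  then show ?thesis by (rule finite_subset) simp
qed

abbreviation rename :: "('n \<Rightarrow> 'm) \<Rightarrow> ('n, 't) sym list \<Rightarrow> ('m, 't) sym list" where
  "rename f s \<equiv> map (map_sym f (\<lambda>t. t)) s"

lemma yields_rename:
  "yields P s w \<Longrightarrow> yields ((\<lambda>(B, r). (f B, rename f r)) ` P) (rename f s) w"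
proof (induction rule: yields.induct)
  case (Nt B r u s v)
  have "(f B, rename f r) \<in> (\<lambda>(B, r). (f B, rename f r)) ` P" using Nt(1) by force
  then show ?case using Nt by (auto intro: yields.Nt)
qed (auto intro: yields.intros)

lemma yields_unrename:
  assumes inj: "inj_on f N" and N: "\<And>B r. (B, r) \<in> P \<Longrightarrow> B \<in> N \<and> nts r \<subseteq> N"
  shows "yields ((\<lambda>(B, r). (f B, rename f r)) ` P) s' w \<Longrightarrow> s' = rename f s \<Longrightarrow> nts s \<subseteq> N \<Longrightarrow> yields P s w"
proof (induction s' w arbitrary: s rule: yields.induct)
  case Nil
  then show ?case by (auto intro: yields.Nil)
next
  case (Tm s' w t)
  then obtain x s1 where s: "s = x # s1" "map_sym f (\<lambda>t. t) x = Tm t" "s' = rename f s1"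
    using Tm.prems(1) by (cases s) auto
  then have "x = Tm t" by (cases x) auto
  then show ?case using Tm.IH[OF s(3)] Tm.prems s by (auto intro!: yields.Tm simp: nts_def)
next
  case (Nt B' r' u s' v)
  then obtain x s1 where s: "s = x # s1" "map_sym f (\<lambda>t. t) x = Nt B'" "s' = rename f s1"
    using Nt.prems(1) by (cases s) auto
  then obtain B where x: "x = Nt B" "f B = B'" by (cases x) auto
  obtain B1 r where r: "(B1, r) \<in> P" "f B1 = B'" "r' = rename f r" using Nt(1) by auto
  have "B \<in> N" using Nt.prems s x by (auto simp: nts_def)
  then have "B1 = B" using inj x r N[OF r(1)] by (auto simp: inj_on_def)
  moreover have "yields P r u" using Nt.IH(1)[OF r(3)] N[OF r(1)] by blast
  moreover have "yields P s1 v" using Nt.IH(2)[OF s(3)] Nt.prems s by (auto simp: nts_def)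
  ultimately show ?case using r(1) s(1) x(1) by (auto intro: yields.Nt)
qed

text \<open>The nonterminals that occur in finitely many productions can be renamed to natural numbers.\<close>

lemma context_free_yields:
  fixes P :: "('n, 't) prods"
  assumes "finite P"
  shows "context_free {w. yields P [Nt S] w}"
proof -
  define N where "N = insert S (fst ` P \<union> (\<Union>p\<in>P. nts (snd p)))"
  have "finite N" using assms by (simp add: N_def finite_nts)
  then obtain f :: "'n \<Rightarrow> nat" where f: "inj_on f N"
    using finite_imp_inj_to_nat_seg by blast
  define P' where "P' = (\<lambda>(B, r). (f B, rename f r)) ` P"
  have N: "B \<in> N \<and> nts r \<subseteq> N" if "(B, r) \<in> P" for B r
    using that by (force simp: N_def)
  have "yields P' [Nt (f S)] w \<longleftrightarrow> yields P [Nt S] w" for w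
  proof
    assume "yields P' [Nt (f S)] w"
    then have 1: "yields ((\<lambda>(B, r). (f B, rename f r)) ` P) (rename f [Nt S]) w"
      by (simp add: P'_def)
    have "nts [Nt S :: ('n, 't) sym] \<subseteq> N" by (auto simp: nts_def N_def)
    then show "yields P [Nt S] w" using yields_unrename[OF f N 1] by blast
  next
    assume "yields P [Nt S] w"
    from yields_rename[OF this, of f] show "yields P' [Nt (f S)] w" by (simp add: P'_def)
  qed
  then have "{w. yields P [Nt S] w} = Lang P' (f S)" by (simp add: Lang_eq_yields)
  moreover have "finite P'" using assms by (simp add: P'_def)
  ultimately show ?thesis unfolding context_free_def by blast
qed


section \<open>Words with reduction in a regular language\<close>

fun run :: "('q \<times> 't \<times> 'q) set \<Rightarrow> 'q \<Rightarrow> 't list \<Rightarrow> 'q \<Rightarrow> bool" where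
  "run \<delta> p [] q \<longleftrightarrow> p = q"
| "run \<delta> p (x # w) q \<longleftrightarrow> (\<exists>r. (p, x, r) \<in> \<delta> \<and> run \<delta> r w q)"

lemma run_append: "run \<delta> p (u @ v) q \<longleftrightarrow> (\<exists>r. run \<delta> p u r \<and> run \<delta> r v q)"
  by (induction u arbitrary: p) auto

inductive dyck :: "'a word \<Rightarrow> bool" where
  Nil: "dyck []"
| Cons: "dyck u \<Longrightarrow> dyck v \<Longrightarrow> dyck (x # u @ letter_inv x # v)"

lemma red_cancel_middle: "red u = [] \<Longrightarrow> red (x # u @ letter_inv x # v) = red v"
  using act_cong[of u "[]" "push (letter_inv x) (red v)"]
  by (simp add: red_Cons red_append reduced_push)

lemma red_dyck: "dyck u \<Longrightarrow> red u = []"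
  by (induction rule: dyck.induct) (simp_all add: red_cancel_middle)

text \<open>Each word is \<open>z\<^sub>0 x\<^sub>1 z\<^sub>1 \<dots> x\<^sub>n z\<^sub>n\<close> with Dyck words \<open>z\<^sub>i\<close> and reduction \<open>x\<^sub>1 \<dots> x\<^sub>n\<close>;
  here the first letter is split off.\<close>

lemma dyck_or_split:
  "dyck w \<or> (\<exists>z x w'. w = z @ x # w' \<and> dyck z \<and> red w = x # red w')"
proof (induction w rule: length_induct)
  case (1 w)
  show ?case
  proof (cases w)
    case Nil
    then show ?thesis by (simp add: dyck.Nil)
  next
    case (Cons x w1)
    show ?thesis
    proof (cases "\<exists>t. red w1 = letter_inv x # t")
      case False
      then have "red w = x # red w1"
        unfolding Cons red_Cons by (cases "red w1") auto
      then show ?thesis using Cons dyck.Nil by (metis append_Nil)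
    next
      case True
      then have "\<not> dyck w1" using red_dyck[of w1] by auto
      moreover have "dyck w1 \<or> (\<exists>z x w'. w1 = z @ x # w' \<and> dyck z \<and> red w1 = x # red w')"
        using "1.IH"[rule_format, of w1] by (simp add: Cons)
      ultimately obtain z y w2 where w1: "w1 = z @ y # w2" "dyck z" "red w1 = y # red w2"
        by blast
      then have y: "y = letter_inv x" "red w = red w2" using True by (auto simp: Cons red_Cons)
      have w: "w = x # z @ letter_inv x # w2" by (simp add: Cons w1 y)
      have "dyck w2 \<or> (\<exists>z x w'. w2 = z @ x # w' \<and> dyck z \<and> red w2 = x # red w')"
        using "1.IH"[rule_format, of w2] by (simp add: w)
      then show ?thesis
      proof
        assume "dyck w2"
        then show ?thesis unfolding w using w1(2) by (auto intro: dyck.Cons)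
      next
        assume "\<exists>z x w'. w2 = z @ x # w' \<and> dyck z \<and> red w2 = x # red w'"
        then obtain z' x' w' where w2: "w2 = z' @ x' # w'" "dyck z'" "red w2 = x' # red w'" by blast
        have "w = (x # z @ letter_inv x # z') @ x' # w'" by (simp add: w w2)
        moreover have "dyck (x # z @ letter_inv x # z')" by (intro dyck.Cons w1 w2)
        ultimately show ?thesis using w2(3) y(2) by metis
      qed
    qed
  qed
qed

text \<open>Nonterminal \<open>Inl (p, q)\<close> stands for the Dyck words that lead from \<open>p\<close> to \<open>q\<close> in the automaton
  \<open>\<delta>\<close>, and \<open>Inr (p, c)\<close> for the words that lead from \<open>p\<close> to \<open>p1\<close> in \<open>\<delta>\<close> and reduce to the same
  as some word leading from \<open>c\<close> to \<open>c1\<close> in \<open>\<epsilon>\<close>.\<close>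

inductive_set cf_prods :: "'q set \<Rightarrow> ('q \<times> 'a letter \<times> 'q) set \<Rightarrow> ('c \<times> 'a letter \<times> 'c) set \<Rightarrow>
    'q \<Rightarrow> 'c \<Rightarrow> (('q \<times> 'q) + ('q \<times> 'c), 'a letter) prods"
  for Q \<delta> \<epsilon> p1 c1 where
  empty: "p \<in> Q \<Longrightarrow> (Inl (p, p), []) \<in> cf_prods Q \<delta> \<epsilon> p1 c1"
| bracket: "(p, x, r) \<in> \<delta> \<Longrightarrow> (s, letter_inv x, t) \<in> \<delta> \<Longrightarrow> q \<in> Q \<Longrightarrow>
    (Inl (p, q), [Tm x, Nt (Inl (r, s)), Tm (letter_inv x), Nt (Inl (t, q))]) \<in> cf_prods Q \<delta> \<epsilon> p1 c1"
| letter: "p \<in> Q \<Longrightarrow> (q, x, r) \<in> \<delta> \<Longrightarrow> (c, x, d) \<in> \<epsilon> \<Longrightarrow>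
    (Inr (p, c), [Nt (Inl (p, q)), Tm x, Nt (Inr (r, d))]) \<in> cf_prods Q \<delta> \<epsilon> p1 c1"
| stop: "p \<in> Q \<Longrightarrow> (Inr (p, c1), [Nt (Inl (p, p1))]) \<in> cf_prods Q \<delta> \<epsilon> p1 c1"

lemma finite_cf_prods:
  fixes \<delta> :: "('q \<times> 'a letter \<times> 'q) set" and \<epsilon> :: "('c \<times> 'a letter \<times> 'c) set"
  assumes "finite Q" "finite \<delta>" "finite \<epsilon>"
  shows "finite (cf_prods Q \<delta> \<epsilon> p1 c1)"
proof -
  let ?f = "\<lambda>((p, x, r), (s, y, t), q).
    (Inl (p, q), [Tm x, Nt (Inl (r, s)), Tm y, Nt (Inl (t, q))]) :: (('q \<times> 'q) + ('q \<times> 'c)) \<times> _"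
  let ?g = "\<lambda>(p, (q, x, r), (c, y, d)).
    (Inr (p, c), [Nt (Inl (p, q)), Tm x, Nt (Inr (r, d))]) :: (('q \<times> 'q) + ('q \<times> 'c)) \<times> _"
  let ?R = "(\<lambda>p. (Inl (p, p), [])) ` Q \<union> ?f ` (\<delta> \<times> \<delta> \<times> Q) \<union> ?g ` (Q \<times> \<delta> \<times> \<epsilon>)
    \<union> (\<lambda>p. (Inr (p, c1), [Nt (Inl (p, p1))])) ` Q"
  have "(B, rhs) \<in> ?R" if "(B, rhs) \<in> cf_prods Q \<delta> \<epsilon> p1 c1" for B rhs
    using that
  proof cases
    case (bracket p x r s t q)
    then have "(B, rhs) = ?f ((p, x, r), (s, letter_inv x, t), q)" by simp
    then have "(B, rhs) \<in> ?f ` (\<delta> \<times> \<delta> \<times> Q)" by (rule image_eqI) (use bracket in simp)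
    then show ?thesis by blast
  next
    case (letter p q x r c d)
    then have "(B, rhs) = ?g (p, (q, x, r), (c, x, d))" by simp
    then have "(B, rhs) \<in> ?g ` (Q \<times> \<delta> \<times> \<epsilon>)" by (rule image_eqI) (use letter in simp)
    then show ?thesis by blast
  qed blast+
  then have "cf_prods Q \<delta> \<epsilon> p1 c1 \<subseteq> ?R" by (rule subrelI)
  then show ?thesis by (rule finite_subset) (use assms in simp)
qed

fun nt_lang :: "('q \<times> 'a letter \<times> 'q) set \<Rightarrow> ('c \<times> 'a letter \<times> 'c) set \<Rightarrow> 'q \<Rightarrow> 'c \<Rightarrow>
    ('q \<times> 'q) + ('q \<times> 'c) \<Rightarrow> 'a word \<Rightarrow> bool" where
  "nt_lang \<delta> \<epsilon> p1 c1 (Inl (p, q)) w \<longleftrightarrow> run \<delta> p w q \<and> red w = []"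
| "nt_lang \<delta> \<epsilon> p1 c1 (Inr (p, c)) w \<longleftrightarrow> run \<delta> p w p1 \<and> (\<exists>v. run \<epsilon> c v c1 \<and> red v = red w)"

fun sent_lang :: "('n \<Rightarrow> 't list \<Rightarrow> bool) \<Rightarrow> ('n, 't) sym list \<Rightarrow> 't list \<Rightarrow> bool" where
  "sent_lang L [] w \<longleftrightarrow> w = []"
| "sent_lang L (Tm t # s) w \<longleftrightarrow> (\<exists>w'. w = t # w' \<and> sent_lang L s w')"
| "sent_lang L (Nt B # s) w \<longleftrightarrow> (\<exists>u v. w = u @ v \<and> L B u \<and> sent_lang L s v)"

lemma yields_cf_prods_sound:
  "yields (cf_prods Q \<delta> \<epsilon> p1 c1) s w \<Longrightarrow> sent_lang (nt_lang \<delta> \<epsilon> p1 c1) s w"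
proof (induction rule: yields.induct)
  case (Nt B rhs u s v)
  from Nt(1) have "nt_lang \<delta> \<epsilon> p1 c1 B u"
  proof (cases rule: cf_prods.cases)
    case (empty p)
    then show ?thesis using Nt.IH(1) by simp
  next
    case (bracket p x r s t q)
    then obtain z z' where "u = x # z @ letter_inv x # z'" "run \<delta> r z s" "red z = []"
        "run \<delta> t z' q" "red z' = []"
      using Nt.IH(1) by auto
    then show ?thesis using bracket by (auto simp: run_append red_cancel_middle)
  next
    case (letter p q x r c d)
    then obtain z w' v' where u: "u = z @ x # w'" "run \<delta> p z q" "red z = []" "run \<delta> r w' p1"
        "run \<epsilon> d v' c1" "red v' = red w'"
      using Nt.IH(1) by auto
    have "red u = red (x # v')"
      using red_cong[of z "[]" "x # w'" "x # v'"] u by (simp add: red_Cons)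
    moreover have "run \<epsilon> c (x # v') c1" using letter u by auto
    moreover have "run \<delta> p u p1" using letter u by (auto simp: run_append)
    ultimately show ?thesis using letter by (metis nt_lang.simps(2))
  next
    case (stop p)
    then show ?thesis using Nt.IH(1) by (auto intro: exI[of _ "[]"])
  qed
  then show ?case using Nt.IH(2) by auto
qed auto

lemma yields_dyck:
  assumes \<delta>: "\<And>p x q. (p, x, q) \<in> \<delta> \<Longrightarrow> q \<in> Q"
  shows "dyck w \<Longrightarrow> run \<delta> p w q \<Longrightarrow> p \<in> Q \<Longrightarrow> yields (cf_prods Q \<delta> \<epsilon> p1 c1) [Nt (Inl (p, q))] w"
proof (induction w arbitrary: p q rule: dyck.induct)
  case Nil
  then show ?case using yields.Nt[OF cf_prods.empty yields.Nil yields.Nil] by fastforce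
next
  case (Cons u v x)
  then obtain r s t where run: "(p, x, r) \<in> \<delta>" "run \<delta> r u s" "(s, letter_inv x, t) \<in> \<delta>" "run \<delta> t v q"
    by (auto simp: run_append)
  have q: "q \<in> Q"
  proof -
    have "run \<delta> t v q \<Longrightarrow> t \<in> Q \<Longrightarrow> q \<in> Q" for t v
      by (induction v arbitrary: t) (use \<delta> in auto)
    then show ?thesis using run \<delta> by blast
  qed
  let ?P = "cf_prods Q \<delta> \<epsilon> p1 c1"
  have "yields ?P ([Tm x] @ [Nt (Inl (r, s))] @ [Tm (letter_inv x)] @ [Nt (Inl (t, q))])
      ([x] @ u @ [letter_inv x] @ v)"
    by (intro yields_append Cons.IH run) (use run \<delta> in \<open>auto intro: yields.intros\<close>)
  then have "yields ?P [Nt (Inl (p, q))] (([x] @ u @ [letter_inv x] @ v) @ [])"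
    by (intro yields.Nt[OF cf_prods.bracket[OF run(1,3) q]] yields.Nil) simp
  then show ?case by simp
qed

lemma yields_cf_prods_complete:
  assumes \<delta>: "\<And>p x q. (p, x, q) \<in> \<delta> \<Longrightarrow> q \<in> Q"
  shows "run \<delta> p w p1 \<Longrightarrow> p \<in> Q \<Longrightarrow> run \<epsilon> c (red w) c1 \<Longrightarrow>
    yields (cf_prods Q \<delta> \<epsilon> p1 c1) [Nt (Inr (p, c))] w"
proof (induction w arbitrary: p c rule: length_induct)
  case (1 w)
  let ?P = "cf_prods Q \<delta> \<epsilon> p1 c1"
  from dyck_or_split[of w] show ?case
  proof
    assume d: "dyck w"
    then have "c = c1" using 1 red_dyck[of w] by simp
    moreover have "yields ?P [Nt (Inr (p, c1))] (w @ [])"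
      by (intro yields.Nt[OF cf_prods.stop] yields.Nil yields_dyck \<delta> d 1)
    ultimately show ?thesis by simp
  next
    assume "\<exists>z x w'. w = z @ x # w' \<and> dyck z \<and> red w = x # red w'"
    then obtain z x w' where w: "w = z @ x # w'" "dyck z" "red w = x # red w'" by blast
    obtain q r where run: "run \<delta> p z q" "(q, x, r) \<in> \<delta>" "run \<delta> r w' p1"
      using 1 w by (auto simp: run_append)
    obtain d where d: "(c, x, d) \<in> \<epsilon>" "run \<epsilon> d (red w') c1" using 1 w by auto
    have "yields ?P [Nt (Inr (r, d))] w'"
      using "1.IH" run \<delta> d by (simp add: w)
    then have "yields ?P ([Nt (Inl (p, q))] @ [Tm x] @ [Nt (Inr (r, d))]) (z @ [x] @ w')"
      by (intro yields_append yields_dyck \<delta> w run 1) (auto intro: yields.intros)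
    then have "yields ?P [Nt (Inr (p, c))] ((z @ [x] @ w') @ [])"
      using 1 by (intro yields.Nt[OF cf_prods.letter[OF _ run(2) d(1)]] yields.Nil) auto
    then show ?thesis by (simp add: w)
  qed
qed

text \<open>If the language of \<open>\<epsilon>\<close> is closed under free reduction, then it contains the reduction of each
  word that is equal in the free group to one of its members, and the grammar need only guess which
  letters of a word survive.\<close>

theorem context_free_run_red:
  assumes fin: "finite \<delta>" "finite \<epsilon>"
    and closed: "\<And>v. run \<epsilon> c0 v c1 \<Longrightarrow> run \<epsilon> c0 (red v) c1"
  shows "context_free {w. run \<delta> p0 w p1 \<and> run \<epsilon> c0 (red w) c1}"
proof -
  define Q where "Q = insert p0 ((\<lambda>(p, x, q). q) ` \<delta>)"
  have \<delta>: "(p, x, q) \<in> \<delta> \<Longrightarrow> q \<in> Q" for p x q by (force simp: Q_def)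
  let ?P = "cf_prods Q \<delta> \<epsilon> p1 c1"
  have "run \<delta> p0 w p1 \<and> run \<epsilon> c0 (red w) c1 \<longleftrightarrow> yields ?P [Nt (Inr (p0, c0))] w" for w
  proof
    assume "run \<delta> p0 w p1 \<and> run \<epsilon> c0 (red w) c1"
    then show "yields ?P [Nt (Inr (p0, c0))] w"
      using yields_cf_prods_complete[of \<delta> Q p0 w p1 \<epsilon> c0 c1] \<delta> by (auto simp: Q_def)
  next
    assume "yields ?P [Nt (Inr (p0, c0))] w"
    from yields_cf_prods_sound[OF this] obtain v where "run \<delta> p0 w p1" "run \<epsilon> c0 v c1" "red v = red w"
      by auto
    then show "run \<delta> p0 w p1 \<and> run \<epsilon> c0 (red w) c1" using closed[of v] by simp
  qed
  moreover have "finite ?P" using fin by (intro finite_cf_prods) (auto simp: Q_def)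
  ultimately show ?thesis using context_free_yields[of ?P "Inr (p0, c0)"] by simp
qed

text \<open>A state is the suffix of a member of \<open>W\<close> that remains to be read.\<close>

definition star_automaton :: "'t list set \<Rightarrow> ('t list \<times> 't \<times> 't list) set" where
  "star_automaton W = {(x # s, x, s) | x s. \<exists>p. p @ x # s \<in> W} \<union> {([], x, s) | x s. x # s \<in> W}"

lemma finite_star_automaton:
  assumes "finite W"
  shows "finite (star_automaton W)"
proof -
  have "star_automaton W \<subseteq> (\<Union>w\<in>W. \<Union>i\<le>length w. {(drop i w, hd (drop i w), tl (drop i w)), ([], hd w, tl w)})"
  proof
    fix e assume "e \<in> star_automaton W"
    then consider p x s where "e = (x # s, x, s)" "p @ x # s \<in> W" | x s where "e = ([], x, s)" "x # s \<in> W"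
      by (auto simp: star_automaton_def)
    then show "e \<in> (\<Union>w\<in>W. \<Union>i\<le>length w. {(drop i w, hd (drop i w), tl (drop i w)), ([], hd w, tl w)})"
    proof cases
      case 1
      then show ?thesis by (intro UN_I[of "p @ x # s"] UN_I[of "length p"]) auto
    next
      case 2
      then show ?thesis by (intro UN_I[of "x # s"] UN_I[of 0]) auto
    qed
  qed
  then show ?thesis by (rule finite_subset) (use assms in auto)
qed

lemma run_star_automaton:
  "run (star_automaton W) [] w [] \<longleftrightarrow> (\<exists>ws\<in>lists W. w = concat ws)"
proof
  have "\<exists>ws\<in>lists W. w = s @ concat ws" if "run (star_automaton W) s w []" for s
    using that
  proof (induction w arbitrary: s)
    case Nil
    then show ?case by (auto intro: bexI[of _ "[]"])
  next
    case (Cons x w)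
    then obtain s' where s': "(s, x, s') \<in> star_automaton W" "run (star_automaton W) s' w []" by auto
    obtain ws where ws: "ws \<in> lists W" "w = s' @ concat ws" using Cons.IH[OF s'(2)] by blast
    from s'(1) show ?case
      unfolding star_automaton_def
    proof (elim UnE CollectE exE conjE, goal_cases)
      case (1 y s'' p)
      then show ?case using ws by auto
    next
      case (2 y s'')
      then show ?case using ws by (intro bexI[of _ "(x # s') # ws"]) auto
    qed
  qed
  then show "run (star_automaton W) [] w [] \<Longrightarrow> \<exists>ws\<in>lists W. w = concat ws" by force
next
  have suffix: "run (star_automaton W) s s []" if "p @ s \<in> W" for p s
    using that
  proof (induction s arbitrary: p)
    case (Cons x s)
    then show ?case using Cons.IH[of "p @ [x]"] by (auto simp: star_automaton_def)
  qed simp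
  have "run (star_automaton W) [] v []" if "v \<in> W" for v
  proof (cases v)
    case (Cons x s)
    then show ?thesis using suffix[of "[x]" s] that by (auto simp: star_automaton_def)
  qed simp
  then have "run (star_automaton W) [] (concat ws) []" if "ws \<in> lists W" for ws
    using that by (induction ws) (auto simp: run_append)
  then show "\<exists>ws\<in>lists W. w = concat ws \<Longrightarrow> run (star_automaton W) [] w []" by blast
qed

context group_endo
begin

definition fix_automaton :: "'a word set \<Rightarrow> ('a word \<times> 'a letter \<times> 'a word) set" where
  "fix_automaton C = {(c, x, d) \<in> C \<times> letters A \<times> C. d = defect_step x c}"

lemma run_fix_automaton:
  "run (fix_automaton C) (defect p) v d \<Longrightarrow> v \<in> words A \<and> d = defect (p @ v)"
proof (induction v arbitrary: p)
  case (Cons x v)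
  then have "x \<in> letters A" "run (fix_automaton C) (defect (p @ [x])) v d"
    by (auto simp: fix_automaton_def defect_snoc)
  then show ?case using Cons.IH[of "p @ [x]"] by simp
qed simp

lemma defect_Nil [simp]: "defect [] = []"
  by (simp add: defect_def)

lemma defect_eq_Nil: "defect w = [] \<longleftrightarrow> red (ext F w) = red w"
proof
  show "defect w = [] \<Longrightarrow> red (ext F w) = red w"
    using red_eqI_inv[of w "ext F w"] by (simp add: defect_def)
  show "red (ext F w) = red w \<Longrightarrow> defect w = []"
    using red_cong[of "word_inv w" "word_inv w" "ext F w" w] by (simp add: defect_def)
qed

theorem context_free_star_fixed:
  assumes "finite A" "finite W" "W \<subseteq> words A"
  shows "context_free {w. (\<exists>ws\<in>lists W. w = concat ws) \<and> red (ext F w) = red w}"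
proof -
  obtain C where C: "finite C" "\<And>w p q. w \<in> words A \<Longrightarrow> reduced w \<Longrightarrow> red (ext F w) = w \<Longrightarrow>
      w = p @ q \<Longrightarrow> defect p \<in> C"
    by (rule finite_defects[OF assms(1)]) blast
  let ?\<epsilon> = "fix_automaton C"
  have fin: "finite ?\<epsilon>" unfolding fix_automaton_def
    by (rule finite_subset[of _ "C \<times> letters A \<times> C"]) (use C(1) assms(1) in \<open>auto simp: finite_letters\<close>)
  have sound: "v \<in> words A \<and> red (ext F v) = red v" if "run ?\<epsilon> [] v []" for v
    using run_fix_automaton[of C "[]" v "[]"] that by (simp flip: defect_eq_Nil)
  have complete: "run ?\<epsilon> [] (red w) []" if w: "w \<in> words A" "red (ext F w) = red w" for w
  proof -
    have r: "red w \<in> words A" "red (ext F (red w)) = red w"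
      using ext_red[of "red w" w] w by auto
    have "run ?\<epsilon> (defect p) q (defect (red w))" if "red w = p @ q" for p q
      using that
    proof (induction q arbitrary: p)
      case (Cons x q)
      have "defect p \<in> C" "defect (p @ [x]) \<in> C"
        using C(2)[OF r(1) reduced_red r(2)] Cons.prems by (metis, metis append_Cons append_Nil append_assoc)
      moreover have "x \<in> letters A" using r(1) Cons.prems by simp
      ultimately have "(defect p, x, defect (p @ [x])) \<in> ?\<epsilon>"
        by (simp add: fix_automaton_def defect_snoc)
      then show ?case using Cons.IH[of "p @ [x]"] Cons.prems by auto
    qed simp
    from this[of "[]" "red w"] show ?thesis using r(2) by (simp add: defect_eq_Nil[THEN iffD2])
  qed
  have "context_free {w. run (star_automaton W) [] w [] \<and> run ?\<epsilon> [] (red w) []}"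
    using sound complete by (intro context_free_run_red finite_star_automaton assms fin) blast
  moreover have "run (star_automaton W) [] w [] \<and> run ?\<epsilon> [] (red w) [] \<longleftrightarrow>
      (\<exists>ws\<in>lists W. w = concat ws) \<and> red (ext F w) = red w" for w
  proof -
    have "run ?\<epsilon> [] (red w) [] \<longleftrightarrow> red (ext F w) = red w" if "ws \<in> lists W" "w = concat ws" for ws
    proof -
      have "concat ws \<in> words A" using that(1) assms(3) by (induction ws) auto
      then have w: "w \<in> words A" using that(2) by simp
      have "red (ext F (red w)) = red (ext F w)" by (rule ext_red) (use w in simp_all)
      then show ?thesis using sound[of "red w"] complete[OF w] by auto
    qed
    then show ?thesis unfolding run_star_automaton by blast
  qed
  ultimately show ?thesis by simp
qed

end


section \<open>The radical\<close>

lemma monoid_End_lift: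
  assumes "\<phi> \<in> monoid_End (free_inverse_monoid A)"
  obtains F where "fim_endo A F" "\<And>w. w \<in> words A \<Longrightarrow> \<phi> (fim_proj A w) = fim_proj A (ext F w)"
proof -
  let ?M = "free_inverse_monoid A"
  have hom: "\<phi> \<in> hom ?M ?M" and one: "\<phi> \<one>\<^bsub>?M\<^esub> = \<one>\<^bsub>?M\<^esub>"
    using assms by (auto simp: monoid_End_def)
  have "\<exists>v. v \<in> words A \<and> (x \<in> letters A \<longrightarrow> fim_proj A v = \<phi> (fim_proj A [x]))" for x
  proof (cases "x \<in> letters A")
    case True
    then have "\<phi> (fim_proj A [x]) \<in> carrier ?M"
      using hom fim_proj_in[of "[x]" A] by (auto simp: hom_def)
    then show ?thesis by (metis fim_carrierE)
  qed (auto intro: exI[of _ "[]"])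
  then obtain F where F: "\<And>x. F x \<in> words A"
      "\<And>x. x \<in> letters A \<Longrightarrow> fim_proj A (F x) = \<phi> (fim_proj A [x])"
    by metis
  have F_ext: "ext F w \<in> words A" for w by (induction w) (auto simp: F)
  have lift: "\<phi> (fim_proj A w) = fim_proj A (ext F w)" if "w \<in> words A" for w
    using that
  proof (induction w)
    case Nil
    then show ?case using one by (simp add: fim_proj_Nil)
  next
    case (Cons x w)
    then have x: "[x] \<in> words A" "w \<in> words A" by auto
    have "\<phi> (fim_proj A ([x] @ w)) = \<phi> (fim_proj A [x]) \<otimes>\<^bsub>?M\<^esub> \<phi> (fim_proj A w)"
      unfolding fim_proj_append[OF x] by (intro hom_mult[OF hom] fim_proj_in x)
    then show ?case using Cons x F F_ext by (simp add: fim_proj_append)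
  qed
  have red: "red (ext F u) = red (ext F v)" if uv: "u \<in> words A" "v \<in> words A" "red u = red v" for u v
  proof -
    have "(u, v) \<in> fg_cong A" using uv by (simp add: fg_cong_iff_red)
    from endo_respects_fg_cong[OF assms this] show ?thesis
      using uv F_ext by (simp add: lift fim_to_fg_proj fg_class_eq_iff)
  qed
  have munn: "munn (ext F u) = munn (ext F v)"
    if uv: "u \<in> words A" "v \<in> words A" "munn u = munn v" "red u = red v" for u v
  proof -
    have "fim_proj A (ext F u) = fim_proj A (ext F v)"
      using fim_proj_eq_iff[OF uv(1,2)] uv by (simp flip: lift)
    then show ?thesis using fim_proj_eq_iff[OF F_ext F_ext] by blast
  qed
  have "fim_endo A F"
    by (intro fim_endo.intro group_endo.intro fim_endo_axioms.intro F(1) red munn)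
  then show thesis using lift by (rule that)
qed

lemma induced_fg_class:
  assumes "\<phi> \<in> monoid_End (free_inverse_monoid A)"
    and "\<And>w. w \<in> words A \<Longrightarrow> \<phi> (fim_proj A w) = fim_proj A (ext F w)"
    and "\<And>w. ext F w \<in> words A" "u \<in> words A"
  shows "induced A \<phi> (fg_cong A `` {u}) = fg_cong A `` {ext F u}"
  using induced_fim_to_fg[OF assms(1) fim_proj_in[OF assms(4)]] assms by (simp add: fim_to_fg_proj)

theorem theorem4p2:
  fixes A :: "'a set"
    and \<phi> :: "'a word set \<Rightarrow> 'a word set"
    and N :: nat
  assumes "finite A"
    and "\<phi> \<in> monoid_End (free_inverse_monoid A)"
    and "N = Curl A (induced A \<phi>)"
  shows "context_free_subset A (Rad A N \<phi>)"
proof -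
  let ?M = "free_inverse_monoid A" and ?G = "free_group A" and ?\<theta> = "induced A \<phi>"
  obtain F where endo: "fim_endo A F"
    and lift: "\<And>w. w \<in> words A \<Longrightarrow> \<phi> (fim_proj A w) = fim_proj A (ext F w)"
    by (rule monoid_End_lift[OF assms(2)]) blast
  interpret fim_endo A F by (rule endo)
  have lift_pow: "(\<phi> ^^ n) (fim_proj A w) = fim_proj A ((ext F ^^ n) w)" if "w \<in> words A" for n w
    by (induction n) (simp_all add: lift that)
  have ind: "(?\<theta> ^^ n) (fg_cong A `` {u}) = fg_cong A `` {(ext F ^^ n) u}" if "u \<in> words A" for n u
    by (induction n) (simp_all add: induced_fg_class[OF assms(2) lift ext_in] that)
  have Fix: "fg_cong A `` {u} \<in> Fix ?G (?\<theta> ^^ n) \<longleftrightarrow> red ((ext F ^^ n) u) = red u"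
    if "u \<in> words A" for n u
    using that by (simp add: Fix_def ind fg_class_eq_iff free_group_def quot_class_in)
  \<comment> \<open>The minimum that defines the curl is attained.\<close>
  have "\<exists>N. N \<ge> 1 \<and> Per ?G ?\<theta> = Fix ?G (?\<theta> ^^ N)"
  proof -
    obtain n where n: "n \<ge> 1"
      "\<And>w m. w \<in> words A \<Longrightarrow> m \<ge> 1 \<Longrightarrow> red ((ext F ^^ m) w) = red w \<Longrightarrow> red ((ext F ^^ n) w) = red w"
      by (rule common_period[OF assms(1)]) blast
    have "g \<in> Fix ?G (?\<theta> ^^ n)" if g: "g \<in> Fix ?G (?\<theta> ^^ m)" "m \<ge> 1" for g m
    proof -
      obtain u where u: "u \<in> words A" "g = fg_cong A `` {u}"
        using g(1) by (auto simp: Fix_def free_group_def elim: quot_carrierE)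
      then show ?thesis using n(2)[OF u(1) g(2)] g(1) Fix by simp
    qed
    then have "Per ?G ?\<theta> = Fix ?G (?\<theta> ^^ n)" using n(1) unfolding Per_def by fastforce
    then show ?thesis using n(1) by blast
  qed
  from LeastI_ex[OF this] have N: "N \<ge> 1" "Per ?G ?\<theta> = Fix ?G (?\<theta> ^^ N)"
    by (simp_all add: assms(3) Curl_def)
  have per: "red ((ext F ^^ N) w) = red w"
    if "w \<in> words A" "m \<ge> 1" "red ((ext F ^^ m) w) = red w" for w m
  proof -
    have "fg_cong A `` {w} \<in> Per ?G ?\<theta>" using that Fix unfolding Per_def by fastforce
    then show ?thesis using that Fix N(2) by simp
  qed
  interpret pow: fim_endo A "pow_letters N" by (rule fim_endo_pow[OF N(1)])
  obtain W where W: "finite W" "W \<subseteq> words A" "\<And>ws. ws \<in> lists W \<Longrightarrow> pow.fixed (concat ws)"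
    "\<And>w. w \<in> words A \<Longrightarrow> pow.fixed w \<Longrightarrow>
      \<exists>ws\<in>lists W. munn (concat ws) = munn w \<and> red (concat ws) = red w"
  proof (rule pow.fixed_points_finitely_generated[OF assms(1)])
    fix w m assume w: "w \<in> words A" "1 \<le> m" "red ((ext (pow_letters N) ^^ m) w) = red w"
    then have "red ((ext F ^^ (N * m)) w) = red w" by (simp add: ext_pow_letters funpow_mult)
    then have "red ((ext F ^^ N) w) = red w" using w N(1) by (intro per[of w "N * m"]) auto
    then show "red (ext (pow_letters N) w) = red w" by (simp add: ext_pow_letters)
  qed blast
  have fixed_iff: "pow.fixed w \<longleftrightarrow> (\<phi> ^^ N) (fim_proj A w) = fim_proj A w" if "w \<in> words A" for w
    using that by (simp add: pow.fixed_def lift_pow fim_proj_eq_iff ext_pow_letters)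
  have Rad_iff: "fim_proj A w \<in> Rad A N \<phi> \<longleftrightarrow> pow.fixed w \<and> red (ext F w) = red w"
    if "w \<in> words A" for w
    using that fixed_iff[OF that] Fix[OF that, of 1]
    by (simp add: Rad_def Fix_def[of ?M] fim_proj_in fim_to_fg_proj)
  define L where "L = {w. (\<exists>ws\<in>lists W. w = concat ws) \<and> red (ext F w) = red w}"
  have L: "L \<subseteq> words A"
  proof -
    have "concat ws \<in> words A" if "ws \<in> lists W" for ws
      using that W(2) by (induction ws) auto
    then show ?thesis by (auto simp: L_def)
  qed
  have "Rad A N \<phi> = fim_proj A ` L"
  proof
    show "fim_proj A ` L \<subseteq> Rad A N \<phi>"
      using L W(3) Rad_iff by (auto simp: L_def)
    show "Rad A N \<phi> \<subseteq> fim_proj A ` L"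
    proof
      fix X assume X: "X \<in> Rad A N \<phi>"
      then obtain w where w: "w \<in> words A" "X = fim_proj A w"
        by (auto simp: Rad_def Fix_def elim: fim_carrierE)
      then have fx: "pow.fixed w" "red (ext F w) = red w" using X Rad_iff by auto
      obtain ws where ws: "ws \<in> lists W" "munn (concat ws) = munn w" "red (concat ws) = red w"
        using W(4)[OF w(1) fx(1)] by blast
      have ws_in: "concat ws \<in> words A" using ws(1) W(2) by (induction ws) auto
      have "red (ext F (concat ws)) = red (ext F w)" using ws ws_in w by (intro ext_red)
      then have "concat ws \<in> L" using ws fx by (auto simp: L_def)
      moreover have "X = fim_proj A (concat ws)" using w ws ws_in by (simp add: fim_proj_eq_iff)
      ultimately show "X \<in> fim_proj A ` L" by blast
    qed
  qed
  moreover have "context_free L"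
    unfolding L_def by (rule context_free_star_fixed[OF assms(1) W(1,2)])
  ultimately show ?thesis using L unfolding context_free_subset_def by blast
qed

end
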